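(* Let $\mathsf H$ be a separable Hilbert space, let $A\subset\mathcal P_2(\mathsf H)$ be a closed subset of $\mathcal P_2^w(\mathsf H)$ (i.e. weakly closed), let $T:A\to A$ be a non-expansive and asymptotically regular map, and let $\mu_k:=T^k(\mu)$, $k\in\mathbb N$, for some $\mu\in A$. Then $T$ has a fixed point if and only if $(\mu_k)_{k\in\mathbb N}$ is bounded in $(\mathcal P_2(\mathsf H),W_2)$; in this case $(\mu_k)_{k\in\mathbb N}$ converges in $\mathcal P_2^w(\mathsf H)$ to a fixed point $\bar\mu$ of $T$ as $k\to\infty$.
   Context: $(\mathsf H,|\cdot|)$ is a separable Hilbert space. $\mathcal P_2(\mathsf H)$ is the set of Borel probability measures $\mu$ on $\mathsf H$ with $\int|x|^2\,\mathrm d\mu<\infty$, and $W_2$ is the $L^2$-Kantorovich-Rubinstein-Wasserstein distance: $W_2^2(\mu_0,\mu_1)$ is the minimum of $\int|x_1-x_2|^2\,\mathrm d\boldsymbol\mu$ over all Borel probability measures $\boldsymbol\mu$ on $\mathsf H\times\mathsf H$ with marginals $\mu_0,\mu_1$. $\mathcal P_2^w(\mathsf H)$ is the set $\mathcal P_2(\mathsf H)$ endowed with the coarsest topology making all maps $\mu\mapsto\int\zeta\,\mathrm d\mu$ continuous, where $\zeta:\mathsf H\to\mathbb R$ ranges over the sequentially weakly continuous functions with $\lim_{|x|\to\infty}\zeta(x)/(1+|x|^2)=0$. For $A\subset\mathcal P_2(\mathsf H)$, a map $T:A\to A$ is non-expansive if $W_2(T(\mu),T(\nu))\le W_2(\mu,\nu)$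 for all $\mu,\nu\in A$; it is asymptotically regular if $\lim_{k\to\infty}W_2(T^{k+1}(\mu),T^k(\mu))=0$ for every $\mu\in A$. *)

theory Defs
  imports "HOL-Probability.Probability"
begin

text \<open>
  A separable Hilbert space is a type of sort
  \<open>{real_inner, complete_space, second_countable_topology}\<close>: for metric spaces, separability
  and second countability coincide.
\<close>

definition P2 :: "'a::real_inner measure set" where
  "P2 = {\<mu>. sets \<mu> = sets borel \<and> prob_space \<mu> \<and> integrable \<mu> (\<lambda>x. (norm x)\<^sup>2)}"

definition plans ::
  "'a::real_inner measure \<Rightarrow> 'a measure \<Rightarrow> ('a \<times> 'a) measure set" where
  "plans \<mu> \<nu> = {\<gamma>. sets \<gamma> = sets borel \<and> prob_space \<gamma> \<and>
      distr \<gamma> borel fst = \<mu> \<and> distr \<gamma> borel snd = \<nu>}"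

text \<open>
  The infimum of the transport cost is attained whenever both measures are in \<open>P2\<close>, and it is
  then finite, so that \<open>enn2real\<close> loses no information. Outside of \<open>P2\<close> the value is irrelevant.
\<close>

definition W2 :: "'a::real_inner measure \<Rightarrow> 'a measure \<Rightarrow> real" where
  "W2 \<mu> \<nu> = sqrt (enn2real
      (INF \<gamma>\<in>plans \<mu> \<nu>. \<integral>\<^sup>+ z. ennreal ((norm (fst z - snd z))\<^sup>2) \<partial>\<gamma>))"

definition W2_bounded :: "'a::real_inner measure set \<Rightarrow> bool" where
  "W2_bounded S \<longleftrightarrow> S \<subseteq> P2 \<and> (\<exists>\<nu>\<in>P2. \<exists>C. \<forall>\<mu>\<in>S. W2 \<nu> \<mu> \<le> C)"

text \<open>Weak convergence of sequences in the Hilbert space, the dual being given by Riesz.\<close>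

definition weakly_converges :: "(nat \<Rightarrow> 'a::real_inner) \<Rightarrow> 'a \<Rightarrow> bool" where
  "weakly_converges x l \<longleftrightarrow> (\<forall>y. (\<lambda>n. x n \<bullet> y) \<longlonglongrightarrow> l \<bullet> y)"

definition seq_weakly_continuous :: "('a::real_inner \<Rightarrow> real) \<Rightarrow> bool" where
  "seq_weakly_continuous \<zeta> \<longleftrightarrow>
     (\<forall>x l. weakly_converges x l \<longrightarrow> (\<lambda>n. \<zeta> (x n)) \<longlonglongrightarrow> \<zeta> l)"

definition P2w_test :: "('a::real_inner \<Rightarrow> real) set" where
  "P2w_test = {\<zeta>. seq_weakly_continuous \<zeta> \<and>
      ((\<lambda>x. \<zeta> x / (1 + (norm x)\<^sup>2)) \<longlongrightarrow> 0) at_infinity}"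

text \<open>
  The test functions are Borel and of at most quadratic growth on a separable Hilbert space, so the
  Bochner integrals below are genuine.
\<close>

definition P2w :: "'a::real_inner measure topology" where
  "P2w = topology_generated_by
     {{\<mu> \<in> P2. (\<integral>x. \<zeta> x \<partial>\<mu>) \<in> U} | \<zeta> U. \<zeta> \<in> P2w_test \<and> open U}"

lemma topspace_P2w [simp]: "topspace P2w = P2"
proof -
  have "(\<lambda>x. 0) \<in> P2w_test"
    by (simp add: P2w_test_def seq_weakly_continuous_def)
  then have "P2 \<in> {{\<mu> \<in> P2. (\<integral>x. \<zeta> x \<partial>\<mu>) \<in> U} | \<zeta> U. \<zeta> \<in> P2w_test \<and> open U}"
    by (intro CollectI exI[of _ "\<lambda>x. 0"] exI[of _ UNIV]) auto
  then show ?thesis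
    unfolding P2w_def topology_generated_by_topspace by blast
qed

definition nonexpansive_on ::
  "'a::real_inner measure set \<Rightarrow> ('a measure \<Rightarrow> 'a measure) \<Rightarrow> bool" where
  "nonexpansive_on A T \<longleftrightarrow> (\<forall>\<mu>\<in>A. \<forall>\<nu>\<in>A. W2 (T \<mu>) (T \<nu>) \<le> W2 \<mu> \<nu>)"

definition asymptotically_regular_on ::
  "'a::real_inner measure set \<Rightarrow> ('a measure \<Rightarrow> 'a measure) \<Rightarrow> bool" where
  "asymptotically_regular_on A T \<longleftrightarrow>
     (\<forall>\<mu>\<in>A. (\<lambda>k. W2 ((T ^^ Suc k) \<mu>) ((T ^^ k) \<mu>)) \<longlonglongrightarrow> 0)"

end

theory Submission
  imports Defs
begin

text \<open>
  A bounded orbit has, by weak compactness, subsequences converging in \<open>P2w\<close> to some \<open>\<nu>\<close>. Opial's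
  property says that \<open>W2 \<nu> (\<mu>\<^sub>k)\<close> is then asymptotically strictly smaller than \<open>W2 \<rho> (\<mu>\<^sub>k)\<close> for every
  \<open>\<rho> \<noteq> \<nu>\<close>. Asymptotic regularity and non-expansiveness give the opposite inequality for \<open>\<rho> = T \<nu>\<close>, so
  \<open>\<nu>\<close> is a fixed point. The distance of the orbit to a fixed point is decreasing, hence convergent, and
  Opial's property rules out two different limit points.

  Compactness and Opial's property both rest on a Skorokhod representation for the weak topology:
  a point \<open>x\<close> is encoded in a real number whose ternary digits record which balls of a countable family
  contain \<open>x\<close>. Convergence of the codes of a bounded sequence forces convergence of its distances to a
  dense set, that is, weak convergence; so the theorems of Helly and Skorokhod on the real line apply.
\<close>

section \<open>Encoding points as real numbers\<close>

text \<open>In infinite dimension the weak topology is not metrizable, and \<open>P2w\<close> is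
  tested only by functions of less than quadratic growth. Second moments may therefore drop in the
  limit, and W2 distances to the orbit need not converge to the distance to a cluster point. Opial's
  property survives because it compares two squared distances to the same measure: the uncontrolled
  second moment of that measure occurs in both and cancels.

  The map \<open>code\<close> is Borel and injective but not continuous, so convergence in law of
  the codes says nothing directly about the measures. It is used path by path, after Skorokhod's
  theorem has made the codes converge. The limit of the codes need not be the code of a point; the
  limit point comes from Riesz's theorem, applied to the limits of the inner products. Bounded
  second moments and Fatou's lemma bound almost every path along a subsequence only; this suffices,
  because convergent codes make distances converge in [0, \<infinity>].\<close>

lemma ternary_digits_eq:
  fixes b c :: "nat \<Rightarrow> real"
  assumes b: "\<And>n. b n \<in> {0, 1}" and c: "\<And>n. c n \<in> {0, 1}"
    and close: "\<bar>(\<Sum>n. b n * (1/3)^n) - (\<Sum>n. c n * (1/3)^n)\<bar> < (1/2) * (1/3)^N"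
    and "m \<le> N"
  shows "b m = c m"
proof (rule ccontr)
  assume "b m \<noteq> c m"
  \<comment> \<open>At the first differing position \<open>k\<close> the terms differ by (1/3)^k,
    while all later positions together contribute at most half of that. Digits 0 and 1 in base 3
    leave this gap; in base 2 it would vanish, as 0111... = 1000... shows.\<close>
  define k where "k = (LEAST j. b j \<noteq> c j)"
  have k: "b k \<noteq> c k" and kmin: "\<And>j. j < k \<Longrightarrow> b j = c j"
    unfolding k_def using \<open>b m \<noteq> c m\<close> by (rule LeastI) (use not_less_Least in blast)
  have "k \<le> N"
    unfolding k_def using \<open>b m \<noteq> c m\<close> \<open>m \<le> N\<close> by (meson Least_le order_trans)
  define a where "a n = (b n - c n) * (1/3::real)^n" for n
  have geo: "summable (\<lambda>n. (1/3::real)^n)" by (rule summable_geometric) simp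
  have digit_summable: "summable (\<lambda>n. e n * (1/3)^n)" if e: "\<And>n. e n \<in> {0, 1::real}" for e
  proof (rule summable_comparison_test'[OF geo, of 0])
    show "norm (e n * (1/3)^n) \<le> (1/3)^n" for n
      using e[of n] by auto
  qed
  note bs = digit_summable[of b, OF b] and cs = digit_summable[of c, OF c]
  have absa: "\<bar>a n\<bar> \<le> (1/3)^n" for n
    using b[of n] c[of n] by (auto simp: a_def)
  have as: "summable a"
    by (rule summable_comparison_test'[OF geo, of 0]) (use absa in auto)
  have "(\<Sum>n. b n * (1/3)^n) - (\<Sum>n. c n * (1/3)^n) = suminf a"
    unfolding suminf_diff[OF bs cs] a_def by (simp add: left_diff_distrib)
  also have "\<dots> = (\<Sum>n. a (n + Suc k)) + sum a {..<Suc k}"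
    by (rule suminf_split_initial_segment[OF as])
  also have "sum a {..<Suc k} = a k"
    using kmin by (simp add: a_def)
  finally have *: "(\<Sum>n. b n * (1/3)^n) - (\<Sum>n. c n * (1/3)^n) = (\<Sum>n. a (n + Suc k)) + a k" .
  have sg: "summable (\<lambda>n. (1/3::real)^(n + Suc k))"
    using geo by (subst summable_iff_shift)
  have sa: "summable (\<lambda>n. norm (a (n + Suc k)))"
    by (rule summable_comparison_test'[OF sg, of 0]) (simp only: real_norm_def abs_idempotent absa)
  have "\<bar>\<Sum>n. a (n + Suc k)\<bar> \<le> (\<Sum>n. norm (a (n + Suc k)))"
    using summable_norm[OF sa] by simp
  also have "\<dots> \<le> (\<Sum>n. (1/3)^(n + Suc k))"
    by (rule suminf_le[OF _ sa sg]) (simp only: real_norm_def absa)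
  also have "\<dots> = (\<Sum>n. (1/3)^(Suc k) * (1/3)^n)"
    by (simp add: power_add mult.commute)
  also have "\<dots> = (1/3)^(Suc k) * (\<Sum>n. (1/3)^n)"
    by (rule suminf_mult[OF geo])
  also have "\<dots> = (1/2) * (1/3)^k"
    by (subst suminf_geometric) auto
  finally have tail: "\<bar>\<Sum>n. a (n + Suc k)\<bar> \<le> (1/2) * (1/3)^k" .
  have "\<bar>a k\<bar> = (1/3)^k"
    using k b[of k] c[of k] by (auto simp: a_def)
  with tail * have "(1/2) * (1/3)^k \<le> \<bar>(\<Sum>n. b n * (1/3)^n) - (\<Sum>n. c n * (1/3)^n)\<bar>"
    by linarith
  moreover have "(1/3::real)^N \<le> (1/3)^k"
    using \<open>k \<le> N\<close> by (intro power_decreasing) auto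
  ultimately show False using close by linarith
qed

definition dense_seq :: "nat \<Rightarrow> 'a::{metric_space, second_countable_topology}" where
  "dense_seq = (SOME d. \<forall>x e. e > 0 \<longrightarrow> (\<exists>i. dist x (d i) < e))"

lemma dense_seqE:
  fixes x :: "'a::{metric_space, second_countable_topology}"
  assumes "e > 0"
  obtains i where "dist x (dense_seq i) < e"
proof -
  obtain D :: "'a set" where D: "countable D" "\<And>X. open X \<Longrightarrow> X \<noteq> {} \<Longrightarrow> \<exists>d\<in>D. d \<in> X"
    using countable_dense_exists by blast
  then have ne: "D \<noteq> {}" by blast
  have "\<exists>i. dist x (from_nat_into D i) < e" if "e > 0" for x e
  proof -
    have "\<exists>d\<in>D. d \<in> ball x e" using that by (intro D(2)) auto
    then obtain d where "d \<in> D" "dist x d < e" by (auto simp: dist_commute)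
    then show ?thesis using D(1) from_nat_into_surj by metis
  qed
  then have "\<exists>d::nat \<Rightarrow> 'a. \<forall>x e. e > 0 \<longrightarrow> (\<exists>i. dist x (d i) < e)"
    by (intro exI[of _ "from_nat_into D"]) auto
  from someI_ex[OF this] assms that show thesis
    unfolding dense_seq_def by blast
qed

text \<open>One index carries a centre and a radius. All nonnegative rational radii occur, so
  membership in these balls determines every distance to a centre.\<close>

definition code_ball :: "nat \<Rightarrow> 'a::{metric_space, second_countable_topology} set" where
  "code_ball n = (case prod_decode n of (i, m) \<Rightarrow> case prod_decode m of (a, b) \<Rightarrow>
     ball (dense_seq i) (real a / real (Suc b)))"

text \<open>If \<open>code (x\<^sub>k)\<close> converges, then membership of \<open>x\<^sub>k\<close> in each of the balls is eventually constant,
  because the ternary digits are only 0 and 1.\<close>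

definition code :: "'a::{metric_space, second_countable_topology} \<Rightarrow> real" where
  "code x = (\<Sum>n. indicator (code_ball n) x * (1/3)^n)"

lemma code_ball_surj: "\<exists>n. code_ball n = ball (dense_seq i) (real a / real (Suc b))"
  by (rule exI[of _ "prod_encode (i, prod_encode (a, b))"]) (simp add: code_ball_def)

lemma code_ball_borel [measurable]: "code_ball n \<in> sets borel"
  by (auto simp: code_ball_def split: prod.split)

lemma code_measurable [measurable]: "code \<in> borel_measurable borel"
  unfolding code_def by measurable

lemma code_close_imp_same_balls:
  assumes "\<bar>code x - code y\<bar> < (1/2) * (1/3)^n"
  shows "x \<in> code_ball n \<longleftrightarrow> y \<in> code_ball n"
proof -
  have "indicator (code_ball n) x = (indicator (code_ball n) y :: real)"
    by (rule ternary_digits_eq[where N = n]) (use assms in \<open>auto simp: code_def indicator_def\<close>)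
  then show ?thesis by (auto simp: indicator_def split: if_splits)
qed

lemma code_bounds: "0 \<le> code x" "code x \<le> 3/2"
proof -
  have geo: "summable (\<lambda>n. (1/3::real)^n)" by (rule summable_geometric) simp
  have s: "summable (\<lambda>n. indicator (code_ball n) x * (1/3::real)^n)"
    by (rule summable_comparison_test'[OF geo, of 0]) (auto simp: indicator_def)
  show "0 \<le> code x" unfolding code_def by (rule suminf_nonneg[OF s]) auto
  have "code x \<le> (\<Sum>n. (1/3::real)^n)"
    unfolding code_def by (rule suminf_le[OF _ s geo]) (auto simp: indicator_def)
  also have "\<dots> = 3/2" by (subst suminf_geometric) auto
  finally show "code x \<le> 3/2" .
qed

lemma rational_between:
  fixes \<alpha> \<beta> :: real
  assumes "0 \<le> \<alpha>" "\<alpha> < \<beta>"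
  obtains a b :: nat where "\<alpha> < real a / real (Suc b)" "real a / real (Suc b) < \<beta>"
proof -
  obtain q where q: "q \<in> \<rat>" "\<alpha> < q" "q < \<beta>" using Rats_dense_in_real[OF assms(2)] by blast
  then have "\<bar>q\<bar> = q" using assms by simp
  with q(1) obtain m n :: nat where "n \<noteq> 0" "q = real m / real n"
    by (metis Rats_abs_nat_div_natE)
  then show thesis using q that[of m "n - 1"] by simp
qed

text \<open>Comparison of the distance with any fixed rational radius eventually stabilizes, so no
  rational separates its liminf from its limsup. The distance thus converges in [0, \<infinity>],
  and a bound along a subsequence excludes the infinite limit.\<close>

lemma code_convergent_imp_dist_convergent:
  fixes x :: "nat \<Rightarrow> 'a::{metric_space, second_countable_topology}"
  assumes conv: "(\<lambda>k. code (x k)) \<longlonglongrightarrow> l" and bdd: "frequently (\<lambda>k. dist (dense_seq i) (x k) < R) sequentially"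
  shows "convergent (\<lambda>k. dist (dense_seq i) (x k))"
proof -
  have stable: "(\<forall>\<^sub>F k in sequentially. x k \<in> code_ball n) \<or> (\<forall>\<^sub>F k in sequentially. x k \<notin> code_ball n)" for n
  proof -
    have "Cauchy (\<lambda>k. code (x k))" using conv by (simp add: LIMSEQ_imp_Cauchy)
    then obtain K where K: "\<And>j k. j \<ge> K \<Longrightarrow> k \<ge> K \<Longrightarrow> dist (code (x j)) (code (x k)) < (1/2) * (1/3)^n"
      unfolding Cauchy_def by (metis half_gt_zero_iff mult.commute mult_1 times_divide_eq_right zero_less_divide_1_iff zero_less_numeral zero_less_power)
    have "x k \<in> code_ball n \<longleftrightarrow> x K \<in> code_ball n" if "k \<ge> K" for k
      using code_close_imp_same_balls K[of k K] that by (auto simp: dist_real_def)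
    then show ?thesis
      unfolding eventually_sequentially by (cases "x K \<in> code_ball n") blast+
  qed
  have stable': "(\<forall>\<^sub>F k in sequentially. dist (dense_seq i) (x k) < real a / real (Suc b)) \<or>
     (\<forall>\<^sub>F k in sequentially. dist (dense_seq i) (x k) \<ge> real a / real (Suc b))" for a b
  proof -
    obtain n where "code_ball n = ball (dense_seq i :: 'a) (real a / real (Suc b))"
      using code_ball_surj by blast
    then have "x k \<in> code_ball n \<longleftrightarrow> dist (dense_seq i) (x k) < real a / real (Suc b)" for k
      by (simp only: mem_ball)
    then show ?thesis using stable[of n] by (simp only: not_less)
  qed
  let ?f = "\<lambda>k. ereal (dist (dense_seq i) (x k))"
  have nn: "0 \<le> liminf ?f" by (rule Liminf_bounded) auto
  have "liminf ?f = limsup ?f"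
  proof (rule ccontr)
    assume "liminf ?f \<noteq> limsup ?f"
    then have "liminf ?f < limsup ?f"
      by (simp add: Liminf_le_Limsup less_le)
    then obtain p where p: "liminf ?f < p" "p < limsup ?f" using dense by blast
    then obtain p' where p': "liminf ?f < p'" "p' < p" using dense by blast
    obtain \<alpha> \<beta> where ab: "p' = ereal \<alpha>" "p = ereal \<beta>"
      using p p' nn by (cases p; cases p') auto
    have "0 \<le> \<alpha>" "\<alpha> < \<beta>" using ab p p' nn by (auto simp: less_imp_le order.trans)
      (metis ereal_less_eq(5) less_imp_le order_trans)
    then obtain a b where q: "\<alpha> < real a / real (Suc b)" "real a / real (Suc b) < \<beta>"
      by (rule rational_between)
    let ?q = "real a / real (Suc b)"
    from stable'[of a b] show False
    proof
      assume "\<forall>\<^sub>F k in sequentially. dist (dense_seq i) (x k) < ?q"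
      then have "limsup ?f \<le> ereal ?q" by (intro Limsup_bounded) (auto elim: eventually_mono)
      then show False using p ab q by (metis ereal_less_eq(3) leD less_imp_le order_trans)
    next
      assume "\<forall>\<^sub>F k in sequentially. dist (dense_seq i) (x k) \<ge> ?q"
      then have "ereal ?q \<le> liminf ?f" by (intro Liminf_bounded) (auto elim: eventually_mono)
      then show False using p' ab q by (metis ereal_less_eq(3) leD less_imp_le order_trans)
    qed
  qed
  then have lim: "?f \<longlonglongrightarrow> liminf ?f"
    using lim_imp_Limsup tendsto_Limsup[of sequentially ?f] by simp
  have "liminf ?f \<le> ereal R"
  proof (rule ccontr)
    assume "\<not> liminf ?f \<le> ereal R"
    then have "\<forall>\<^sub>F k in sequentially. ereal R < ?f k" by (intro less_LiminfD) auto
    then have "\<forall>\<^sub>F k in sequentially. \<not> dist (dense_seq i) (x k) < R"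
      by (rule eventually_mono) auto
    then show False using bdd by (simp add: frequently_def)
  qed
  then obtain r where "liminf ?f = ereal r" using nn by (cases "liminf ?f") auto
  then show ?thesis using lim by (auto simp: convergent_def)
qed

section \<open>Weak convergence in Hilbert spaces\<close>

text \<open>The representing vector minimizes \<open>J\<close>, the squared norm minus 2 f.
  Minimizing sequences are Cauchy by the parallelogram law, and stationarity at the minimizer is the
  required identity.\<close>

lemma riesz_representation:
  fixes f :: "'a::{real_inner, complete_space} \<Rightarrow> real"
  assumes add: "\<And>x y. f (x + y) = f x + f y" and scale: "\<And>c x. f (c *\<^sub>R x) = c * f x"
    and bound: "\<And>x. \<bar>f x\<bar> \<le> R * norm x"
  obtains l where "\<And>y. f y = l \<bullet> y"
proof -
  define J where "J x = x \<bullet> x - 2 * f x" for x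
  have diff: "f (x - y) = f x - f y" for x y
    using add[of x "(-1) *\<^sub>R y"] scale[of "-1" y] by simp
  have J_low: "- R\<^sup>2 \<le> J x" for x
  proof -
    have "0 \<le> (norm x - R)\<^sup>2" by simp
    then show ?thesis using bound[of x]
      by (simp add: J_def power2_norm_eq_inner[symmetric] power2_diff algebra_simps)
  qed
  then have bdd: "bdd_below (range J)" by (intro bdd_belowI2[of UNIV "- R\<^sup>2" J])
  define I where "I = Inf (range J)"
  have I_le: "I \<le> J x" for x unfolding I_def by (rule cInf_lower[OF _ bdd]) auto
  have "\<exists>x. J x < I + 1 / real (Suc n)" for n
  proof -
    have "Inf (range J) < I + 1 / real (Suc n)" by (simp add: I_def)
    then show ?thesis using cInf_lessD[of "range J"] by auto
  qed
  then obtain x where x: "\<And>n. J (x n) < I + 1 / real (Suc n)" by metis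
  have par: "(norm (a - b))\<^sup>2 = 2 * J a + 2 * J b - 4 * J ((1/2) *\<^sub>R (a + b))" for a b
    unfolding J_def scale add by (simp add: power2_norm_eq_inner inner_simps inner_commute algebra_simps)
  have close: "(norm (x m - x n))\<^sup>2 \<le> 4 / real (Suc N)" if "m \<ge> N" "n \<ge> N" for m n N
  proof -
    have "1 / real (Suc m) \<le> 1 / real (Suc N)" "1 / real (Suc n) \<le> 1 / real (Suc N)"
      using that by (auto intro: divide_left_mono)
    then show ?thesis using par[of "x m" "x n"] x[of m] x[of n] I_le[of "(1/2) *\<^sub>R (x m + x n)"] by linarith
  qed
  have "Cauchy x"
  proof (rule CauchyI)
    fix e :: real assume "0 < e"
    then obtain N where N: "4 / e\<^sup>2 < real N" using reals_Archimedean2 by blast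
    have "norm (x m - x n) < e" if "m \<ge> N" "n \<ge> N" for m n
    proof (rule power2_less_imp_less)
      have "4 / e\<^sup>2 < real (Suc N)" using N by simp
      then have "4 / real (Suc N) < e\<^sup>2" using \<open>0 < e\<close> by (simp add: field_simps)
      then show "(norm (x m - x n))\<^sup>2 < e\<^sup>2" using close[OF that] by linarith
    qed (use \<open>0 < e\<close> in simp)
    then show "\<exists>M. \<forall>m\<ge>M. \<forall>n\<ge>M. norm (x m - x n) < e" by blast
  qed
  then obtain l where l: "x \<longlonglongrightarrow> l" using Cauchy_convergent_iff convergent_def by blast
  have "bounded_linear f"
    by (rule bounded_linear_intro[where K = R]) (auto simp: add scale bound mult.commute)
  then have "(\<lambda>n. f (x n)) \<longlonglongrightarrow> f l" using l by (rule bounded_linear.tendsto)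
  then have "(\<lambda>n. J (x n)) \<longlonglongrightarrow> J l"
    unfolding J_def by (intro tendsto_diff tendsto_inner tendsto_mult tendsto_const l)
  moreover have "(\<lambda>n. I + 1 / real (Suc n)) \<longlonglongrightarrow> I + 0"
    by (intro tendsto_add tendsto_const LIMSEQ_Suc[OF lim_1_over_n])
  ultimately have Jl: "J l \<le> I"
    using x by (intro LIMSEQ_le[where Y = "\<lambda>n. I + 1 / real (Suc n)"]) (auto intro: less_imp_le)
  have "f y = l \<bullet> y" for y
  proof (rule ccontr)
    assume "f y \<noteq> l \<bullet> y"
    then have y0: "y \<noteq> 0" using scale[of 0 0] by auto
    \<comment> \<open>This step length minimizes \<open>J\<close> on the line through
      \<open>l\<close> in direction \<open>y\<close>.\<close>
    define t where "t = (f y - l \<bullet> y) / (y \<bullet> y)"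
    have "J (l + t *\<^sub>R y) = J l + t\<^sup>2 * (y \<bullet> y) - 2 * t * (f y - l \<bullet> y)"
      unfolding J_def add scale by (simp add: inner_simps inner_commute power2_eq_square algebra_simps)
    also have "\<dots> = J l - (f y - l \<bullet> y)\<^sup>2 / (y \<bullet> y)"
      using y0 by (simp add: t_def power2_eq_square field_simps)
    also have "\<dots> < J l" using y0 \<open>f y \<noteq> l \<bullet> y\<close> by simp
    finally show False using Jl I_le[of "l + t *\<^sub>R y"] by simp
  qed
  then show thesis by (rule that)
qed

text \<open>In the difference of the squared distances to two dense points the norm of
  \<open>x k\<close> cancels, leaving an inner product with the difference of these points. Such
  differences are dense and the sequence is bounded, so all inner products converge; Riesz turns
  their limit into a point.\<close>

lemma code_convergent_imp_weakly_convergent: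
  fixes x :: "nat \<Rightarrow> 'a::{real_inner, complete_space, second_countable_topology}"
  assumes conv: "(\<lambda>k. code (x k)) \<longlonglongrightarrow> c"
    and freq: "frequently (\<lambda>k. norm (x k) < R) sequentially"
  obtains l where "weakly_converges x l"
proof -
  have dconv: "convergent (\<lambda>k. dist (dense_seq i) (x k))" for i
  proof (rule code_convergent_imp_dist_convergent[OF conv])
    show "frequently (\<lambda>k. dist (dense_seq i) (x k) < norm (dense_seq i :: 'a) + R) sequentially"
      using freq by (rule frequently_elim1)
        (metis add_strict_left_mono dist_norm norm_triangle_ineq4 order_le_less_trans)
  qed
  obtain B where B: "\<And>k. norm (x k) \<le> B" "B > 0"
  proof -
    have "Bseq (\<lambda>k. dist (dense_seq 0) (x k))" using dconv by (rule convergent_imp_Bseq)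
    then obtain K where K: "K > 0" "\<And>k. dist (dense_seq 0) (x k) \<le> K" unfolding Bseq_def by auto
    have "norm (x k) \<le> norm (dense_seq 0 :: 'a) + K" for k
      using K(2)[of k] norm_triangle_ineq2[of "x k" "dense_seq 0"] by (simp add: dist_norm norm_minus_commute)
    then show thesis using that[of "norm (dense_seq 0 :: 'a) + K"] K(1)
      by (smt (verit) norm_ge_zero)
  qed
  have sq: "2 * (x k \<bullet> (dense_seq i - dense_seq j)) =
     (dist (dense_seq j) (x k))\<^sup>2 - (dist (dense_seq i) (x k))\<^sup>2
       + (norm (dense_seq i :: 'a))\<^sup>2 - (norm (dense_seq j :: 'a))\<^sup>2" for i j k
    by (simp add: dist_norm power2_norm_eq_inner inner_simps inner_commute)
  have cd: "convergent (\<lambda>k. x k \<bullet> (dense_seq i - dense_seq j))" for i j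
  proof -
    obtain a b where "(\<lambda>k. dist (dense_seq i) (x k)) \<longlonglongrightarrow> a" "(\<lambda>k. dist (dense_seq j) (x k)) \<longlonglongrightarrow> b"
      using dconv unfolding convergent_def by blast
    then have "(\<lambda>k. (1/2) * ((dist (dense_seq j) (x k))\<^sup>2 - (dist (dense_seq i) (x k))\<^sup>2
       + (norm (dense_seq i :: 'a))\<^sup>2 - (norm (dense_seq j :: 'a))\<^sup>2)) \<longlonglongrightarrow>
        (1/2) * (b\<^sup>2 - a\<^sup>2 + (norm (dense_seq i :: 'a))\<^sup>2 - (norm (dense_seq j :: 'a))\<^sup>2)"
      by (intro tendsto_intros)
    then show ?thesis unfolding sq[symmetric] convergent_def by auto
  qed
  have cy: "convergent (\<lambda>k. x k \<bullet> y)" for y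
  proof (rule Cauchy_convergent, rule metric_CauchyI)
    fix e :: real assume "0 < e"
    define \<delta> where "\<delta> = e / (4 * B)"
    have "\<delta> > 0" using B \<open>0 < e\<close> by (simp add: \<delta>_def)
    \<comment> \<open>Approximating \<open>y + dense_seq 0\<close> by one dense point approximates
      \<open>y\<close> by a difference of two.\<close>
    then obtain i where "dist (y + dense_seq 0) (dense_seq i) < \<delta>" by (rule dense_seqE)
    then have i: "norm (y - (dense_seq i - dense_seq 0)) < \<delta>" by (simp add: dist_norm algebra_simps)
    have app: "\<bar>x k \<bullet> y - x k \<bullet> (dense_seq i - dense_seq 0)\<bar> \<le> e / 4" for k
    proof -
      have "\<bar>x k \<bullet> (y - (dense_seq i - dense_seq 0))\<bar> \<le> norm (x k) * norm (y - (dense_seq i - dense_seq 0))"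
        by (rule Cauchy_Schwarz_ineq2)
      also have "\<dots> \<le> B * \<delta>" using B i by (intro mult_mono) auto
      finally show ?thesis using B by (simp add: \<delta>_def inner_diff_right)
    qed
    have "Cauchy (\<lambda>k. x k \<bullet> (dense_seq i - dense_seq 0))" using cd convergent_Cauchy by blast
    then obtain N where N: "\<And>m n. m \<ge> N \<Longrightarrow> n \<ge> N \<Longrightarrow>
        dist (x m \<bullet> (dense_seq i - dense_seq 0)) (x n \<bullet> (dense_seq i - dense_seq 0)) < e / 2"
      using \<open>0 < e\<close> unfolding Cauchy_def by (metis half_gt_zero)
    have "dist (x m \<bullet> y) (x n \<bullet> y) < e" if "m \<ge> N" "n \<ge> N" for m n
      using N[OF that] app[of m] app[of n] unfolding dist_real_def by linarith
    then show "\<exists>M. \<forall>m\<ge>M. \<forall>n\<ge>M. dist (x m \<bullet> y) (x n \<bullet> y) < e" by blast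
  qed
  define f where "f y = lim (\<lambda>k. x k \<bullet> y)" for y
  have f: "(\<lambda>k. x k \<bullet> y) \<longlonglongrightarrow> f y" for y
    using cy unfolding f_def by (simp add: convergent_LIMSEQ_iff)
  obtain l where "\<forall>y. f y = l \<bullet> y"
  proof (rule riesz_representation[of f B])
    show "f (y + z) = f y + f z" for y z
      using tendsto_add[OF f[of y] f[of z]] f[of "y + z"]
      by (intro LIMSEQ_unique) (auto simp: inner_add_right)
    show "f (c *\<^sub>R y) = c * f y" for c y
      using tendsto_mult[OF tendsto_const[of c] f[of y]] f[of "c *\<^sub>R y"]
      by (intro LIMSEQ_unique) auto
    show "\<bar>f y\<bar> \<le> B * norm y" for y
    proof (rule LIMSEQ_le_const2[OF tendsto_rabs[OF f]])
      have "\<bar>x k \<bullet> y\<bar> \<le> B * norm y" for k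
        using Cauchy_Schwarz_ineq2[of "x k" y] B by (meson mult_right_mono norm_ge_zero order_trans)
      then show "\<exists>N. \<forall>k\<ge>N. \<bar>x k \<bullet> y\<bar> \<le> B * norm y" by blast
    qed
  next
    fix l assume "\<And>y. f y = l \<bullet> y"
    then show thesis by (intro that allI)
  qed
  then have "(\<lambda>k. x k \<bullet> y) \<longlonglongrightarrow> l \<bullet> y" for y using f[of y] by simp
  then have "weakly_converges x l" unfolding weakly_converges_def by (rule allI)
  then show thesis by (rule that)
qed

text \<open>Codes lie in a compact interval, so Bolzano-Weierstrass on the line yields a subsequence
  with convergent codes.\<close>

lemma bounded_imp_weakly_convergent_subsequence:
  fixes x :: "nat \<Rightarrow> 'a::{real_inner, complete_space, second_countable_topology}"
  assumes "\<And>k. norm (x k) \<le> R"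
  obtains r l where "strict_mono (r :: nat \<Rightarrow> nat)" "weakly_converges (x \<circ> r) l"
proof -
  have "seq_compact {0..3/2::real}" using compact_imp_seq_compact by blast
  moreover have "\<forall>k. code (x k) \<in> {0..3/2}" using code_bounds by auto
  ultimately obtain r c where r: "strict_mono (r :: nat \<Rightarrow> nat)" "(\<lambda>k. code (x (r k))) \<longlonglongrightarrow> c"
    unfolding seq_compact_def comp_def by meson
  have "norm ((x \<circ> r) k) < R + 1" for k
    using assms[of "r k"] by simp
  then have "frequently (\<lambda>k. norm ((x \<circ> r) k) < R + 1) sequentially"
    by (intro eventually_frequently[OF _ always_eventually] allI) auto
  with r(2) obtain l where "weakly_converges (x \<circ> r) l"
    using code_convergent_imp_weakly_convergent[of "x \<circ> r"] by auto
  with r(1) show thesis by (rule that)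
qed

section \<open>Decoding\<close>

text \<open>If \<open>B\<close> is one of the coded balls, any point whose code is this close to
  that of a point of \<open>B\<close> has the same digit for \<open>B\<close>. So this open set
  meets the range of \<open>code\<close> exactly in the codes of points of \<open>B\<close>. The
  union over \<open>n\<close> avoids choosing among the indices of one ball.\<close>

definition code_nbhd :: "'a::{metric_space, second_countable_topology} set \<Rightarrow> real set" where
  "code_nbhd B = (\<Union>n\<in>{n. code_ball n = B}. \<Union>z\<in>B. ball (code z) ((1/2) * (1/3)^n))"

lemma open_code_nbhd: "open (code_nbhd B)"
  by (auto simp: code_nbhd_def)

lemma code_mem_nbhd_iff:
  fixes x :: "'a::{metric_space, second_countable_topology}"
  shows "code x \<in> code_nbhd (ball (dense_seq i :: 'a) (1 / real (Suc m))) \<longleftrightarrow> x \<in> ball (dense_seq i) (1 / real (Suc m))"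
    (is "code x \<in> code_nbhd ?B \<longleftrightarrow> _")
proof
  assume "code x \<in> code_nbhd ?B"
  then obtain n and z :: 'a where n: "code_ball n = ?B" and z: "z \<in> ?B"
    and close: "code x \<in> ball (code z) ((1/2) * (1/3)^n)"
    unfolding code_nbhd_def by blast
  from close have "\<bar>code z - code x\<bar> < (1/2) * (1/3)^n" by (simp only: mem_ball dist_real_def)
  then have "z \<in> code_ball n \<longleftrightarrow> x \<in> code_ball n" by (rule code_close_imp_same_balls)
  then show "x \<in> ?B" using z by (simp only: n)
next
  assume x: "x \<in> ?B"
  have "\<exists>n. code_ball n = ?B" using code_ball_surj[of i 1 m] by (simp only: of_nat_1)
  then obtain n where n: "code_ball n = ?B" ..
  show "code x \<in> code_nbhd ?B"
    unfolding code_nbhd_def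
    by (rule UN_I[of n], simp only: n mem_Collect_eq, rule UN_I[of x], rule x) simp
qed

text \<open>A Borel left inverse of \<open>code\<close>, obtained without descriptive set theory: the digit saying whether
  \<open>x\<close> lies in a ball is already determined on the open set \<open>code_nbhd\<close>, so the centres of small balls
  around \<open>x\<close> can be read off measurably.\<close>

definition decode :: "real \<Rightarrow> 'a::{real_inner, complete_space, second_countable_topology}" where
  "decode y = (let g = (\<lambda>m. dense_seq (LEAST i. y \<in> code_nbhd (ball (dense_seq i :: 'a) (1 / real (Suc m)))) :: 'a)
     in if Cauchy g then lim g else 0)"

lemma decode_code [simp]:
  fixes x :: "'a::{real_inner, complete_space, second_countable_topology}"
  shows "decode (code x) = x"
proof -
  define g where "g m = (dense_seq (LEAST i. x \<in> ball (dense_seq i :: 'a) (1 / real (Suc m))) :: 'a)" for m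
  have g: "dist (g m) x \<le> 1 / real (Suc m)" for m
  proof -
    obtain i where "dist x (dense_seq i) < 1 / real (Suc m)"
      by (rule dense_seqE[of "1 / real (Suc m)" x]) simp
    then have "x \<in> ball (dense_seq i) (1 / real (Suc m))" by (simp only: mem_ball dist_commute)
    then have "x \<in> ball (g m) (1 / real (Suc m))" unfolding g_def by (rule LeastI)
    then show ?thesis by (simp only: mem_ball less_imp_le)
  qed
  have "(\<lambda>m. dist (g m) x) \<longlonglongrightarrow> 0"
  proof (rule tendsto_sandwich[OF _ _ tendsto_const LIMSEQ_Suc[OF lim_1_over_n]])
    show "\<forall>\<^sub>F m in sequentially. dist (g m) x \<le> 1 / real (Suc m)"
      using g by (intro always_eventually allI)
  qed simp
  then have lim: "g \<longlonglongrightarrow> x" by (rule tendsto_dist_iff[THEN iffD2])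
  have "decode (code x) = (if Cauchy g then lim g else 0)"
    unfolding decode_def Let_def code_mem_nbhd_iff g_def ..
  also have "\<dots> = x" using LIMSEQ_imp_Cauchy[OF lim] limI[OF lim] by simp
  finally show ?thesis .
qed

lemma decode_measurable [measurable]:
  "(decode :: real \<Rightarrow> 'a::{real_inner, complete_space, second_countable_topology}) \<in> borel_measurable borel"
proof -
  have [measurable]: "code_nbhd B \<in> sets borel" for B :: "'a set"
    using open_code_nbhd by (rule borel_open)
  define g where "g m y = (dense_seq (LEAST i. y \<in> code_nbhd (ball (dense_seq i :: 'a) (1 / real (Suc m)))) :: 'a)" for m y
  have g [measurable]: "g m \<in> borel_measurable borel" for m
    unfolding g_def by measurable
  \<comment> \<open>Replacing \<open>g\<close> by 0 where it is not Cauchy gives convergence at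
    every point, so \<open>decode\<close> is an everywhere limit of Borel functions.\<close>
  define h where "h m y = (if Cauchy (\<lambda>m. g m y) then g m y else 0)" for m y
  have "h m \<in> borel_measurable borel" for m
    unfolding h_def by measurable
  moreover have "(\<lambda>m. h m y) \<longlonglongrightarrow> decode y" for y
  proof -
    have "decode y = (if Cauchy (\<lambda>m. g m y) then lim (\<lambda>m. g m y) else 0)"
      unfolding decode_def Let_def g_def ..
    then show ?thesis
      by (cases "Cauchy (\<lambda>m. g m y)")
        (simp_all add: h_def Cauchy_convergent convergent_LIMSEQ_iff[symmetric])
  qed
  ultimately show ?thesis by (rule borel_measurable_LIMSEQ_metric)
qed

section \<open>Test functions separate measures\<close>

text \<open>For a point \<open>x\<close> outside the ball, the direction \<open>x - a\<close>
  violates the halfspace condition. A violated condition is open in the direction, so some dense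
  direction violates it too.\<close>

lemma cball_eq_Inter_halfspaces:
  fixes a :: "'a::{real_inner, second_countable_topology}"
  assumes "0 \<le> r"
  shows "cball a r = (\<Inter>i. {x. x \<bullet> dense_seq i \<le> a \<bullet> dense_seq i + r * norm (dense_seq i :: 'a)})"
proof (intro equalityI subsetI)
  fix x assume "x \<in> cball a r"
  then have "norm (x - a) \<le> r" by (simp add: dist_norm norm_minus_commute)
  then have "(x - a) \<bullet> u \<le> r * norm u" for u
    by (meson Cauchy_Schwarz_ineq2 abs_le_D1 mult_right_mono norm_ge_zero order_trans)
  then show "x \<in> (\<Inter>i. {x. x \<bullet> dense_seq i \<le> a \<bullet> dense_seq i + r * norm (dense_seq i :: 'a)})"
    by (simp add: inner_diff_left algebra_simps)
next
  fix x :: 'a assume x: "x \<in> (\<Inter>i. {x. x \<bullet> dense_seq i \<le> a \<bullet> dense_seq i + r * norm (dense_seq i :: 'a)})"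
  have "(x - a) \<bullet> (x - a) \<le> r * norm (x - a)"
  proof (rule ccontr)
    assume "\<not> ?thesis"
    then have "x - a \<in> {u. r * norm u < (x - a) \<bullet> u}" by simp
    moreover have "open {u. r * norm u < (x - a) \<bullet> u}"
      by (intro open_Collect_less continuous_intros)
    ultimately obtain e where e: "e > 0" "ball (x - a) e \<subseteq> {u. r * norm u < (x - a) \<bullet> u}"
      using open_contains_ball by blast
    obtain i where "dist (x - a) (dense_seq i) < e" using e(1) by (rule dense_seqE)
    then have "r * norm (dense_seq i :: 'a) < (x - a) \<bullet> dense_seq i" using e(2) by auto
    moreover have "x \<bullet> dense_seq i \<le> a \<bullet> dense_seq i + r * norm (dense_seq i :: 'a)"
      using x by auto
    ultimately show False by (simp add: inner_diff_left)
  qed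
  then have "norm (x - a) * norm (x - a) \<le> r * norm (x - a)"
    by (simp add: power2_norm_eq_inner[symmetric] power2_eq_square)
  then have "norm (x - a) \<le> r"
    using assms by (cases "norm (x - a) = 0") (auto simp: mult_le_cancel_right)
  then show "x \<in> cball a r" by (simp add: dist_norm norm_minus_commute)
qed

text \<open>Finite families of halfspaces are taken to obtain an intersection-stable generator of
  the Borel sets. Its members depend on finitely many inner products, which makes their indicators
  limits of weakly continuous functions.\<close>

definition polyhedra :: "'a::real_inner set set" where
  "polyhedra = (\<lambda>J. {x. \<forall>(y, c)\<in>J. x \<bullet> y \<le> c}) ` {J. finite J}"

lemma halfspace_in_polyhedra: "{x. x \<bullet> y \<le> c} \<in> polyhedra"
  unfolding polyhedra_def by (rule image_eqI[of _ _ "{(y, c)}"]) auto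

text \<open>By separability every open set is a countable union of closed balls, and these are
  countable intersections of halfspaces; hence weak and norm topology lead to the same measurable
  sets.\<close>

lemma sets_borel_eq_sigma_polyhedra:
  "sets (borel :: 'a::{real_inner, second_countable_topology} measure) = sigma_sets UNIV polyhedra"
proof
  have "P \<in> sets borel" if P: "P \<in> polyhedra" for P :: "'a set"
  proof -
    obtain J where J: "finite J" "P = {x. \<forall>(y, c)\<in>J. x \<bullet> y \<le> c}"
      using P unfolding polyhedra_def by blast
    have "P = (\<Inter>(y, c)\<in>J. {x. x \<bullet> y \<le> c})" unfolding J by auto
    moreover have "closed {x. x \<bullet> y \<le> c}" for y :: 'a and c
      by (intro closed_Collect_le continuous_intros)
    ultimately have "closed P" by (auto intro!: closed_INT)
    then show ?thesis by (rule borel_closed)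
  qed
  then have "polyhedra \<subseteq> sets (borel :: 'a measure)" by blast
  then show "sigma_sets UNIV polyhedra \<subseteq> sets (borel :: 'a measure)"
    using sets.sigma_sets_subset[of polyhedra "borel :: 'a measure"] by simp
next
  interpret sigma_algebra "UNIV :: 'a set" "sigma_sets UNIV polyhedra"
    by (rule sigma_algebra_sigma_sets) simp
  have cball: "cball a r \<in> sigma_sets UNIV polyhedra" if "0 \<le> r" for a :: 'a and r
    unfolding cball_eq_Inter_halfspaces[OF that]
    by (rule countable_INT) (use halfspace_in_polyhedra sigma_sets.Basic in blast)+
  have "U \<in> sigma_sets UNIV polyhedra" if "open U" for U :: "'a set"
  proof -
    define I where "I = {(i, m). cball (dense_seq i :: 'a) (1 / real (Suc m)) \<subseteq> U}"
    have "U = (\<Union>(i, m)\<in>I. cball (dense_seq i) (1 / real (Suc m)))"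
    proof (intro equalityI subsetI)
      fix x assume "x \<in> U"
      then obtain e where e: "e > 0" "ball x e \<subseteq> U" using \<open>open U\<close> open_contains_ball by blast
      then obtain m where m: "1 / real (Suc m) < e / 2"
        using nat_approx_posE[of "e / 2"] by auto
      obtain i where i: "dist x (dense_seq i) < 1 / real (Suc m)" by (rule dense_seqE[of "1 / real (Suc m)" x]) simp
      have "cball (dense_seq i) (1 / real (Suc m)) \<subseteq> ball x e"
      proof
        fix y :: 'a assume "y \<in> cball (dense_seq i) (1 / real (Suc m))"
        then have "dist (dense_seq i) y \<le> 1 / real (Suc m)" by (simp only: mem_cball)
        with i m dist_triangle[of x y "dense_seq i"] show "y \<in> ball x e"
          unfolding mem_ball by linarith
      qed
      then have "(i, m) \<in> I" using e(2) unfolding I_def by blast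
      moreover have "x \<in> cball (dense_seq i) (1 / real (Suc m))"
        using i unfolding mem_cball dist_commute[of x] by linarith
      ultimately show "x \<in> (\<Union>(i, m)\<in>I. cball (dense_seq i) (1 / real (Suc m)))" by blast
    next
      fix x :: 'a assume "x \<in> (\<Union>(i, m)\<in>I. cball (dense_seq i) (1 / real (Suc m)))"
      then show "x \<in> U" unfolding I_def by blast
    qed
    moreover have "(\<Union>(i, m)\<in>I. cball (dense_seq i :: 'a) (1 / real (Suc m))) \<in> sigma_sets UNIV polyhedra"
    proof (rule countable_UN'')
      show "countable I" by (rule countableI_type)
      show "(case x of (i, m) \<Rightarrow> cball (dense_seq i :: 'a) (1 / real (Suc m))) \<in> sigma_sets UNIV polyhedra" for x
        using cball by (cases x) simp
    qed
    ultimately show ?thesis by simp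
  qed
  then have "sigma_sets UNIV {S :: 'a set. open S} \<subseteq> sigma_sets UNIV polyhedra"
    by (intro sigma_sets_subset) auto
  then show "sets (borel :: 'a measure) \<subseteq> sigma_sets UNIV polyhedra"
    by (simp add: borel_def)
qed

text \<open>A form of Pettis' theorem. It is meant for weak limits of measurable maps, which are
  pointwise limits only after taking inner products.\<close>

lemma borel_measurable_if_inner_measurable:
  fixes f :: "'b \<Rightarrow> 'a::{real_inner, second_countable_topology}"
  assumes [measurable]: "\<And>y. (\<lambda>w. f w \<bullet> y) \<in> borel_measurable M"
  shows "f \<in> borel_measurable M"
proof (rule measurable_sigma_sets[OF sets_borel_eq_sigma_polyhedra])
  fix P :: "'a set" assume "P \<in> polyhedra"
  then obtain J where J: "finite J" "P = {x. \<forall>(y, c)\<in>J. x \<bullet> y \<le> c}"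
    unfolding polyhedra_def by blast
  have "f -` P \<inter> space M = {w \<in> space M. \<forall>p\<in>J. f w \<bullet> fst p \<le> snd p}"
    unfolding J by auto
  also have "\<dots> \<in> sets M"
  proof (rule sets.sets_Collect_finite_All)
    show "{w \<in> space M. f w \<bullet> fst p \<le> snd p} \<in> sets M" for p
      by measurable
  qed (rule J(1))
  finally show "f -` P \<inter> space M \<in> sets M" .
qed auto

section \<open>Weakly continuous test functions and uniqueness of measures\<close>

lemma seq_weakly_continuous_tendsto:
  "seq_weakly_continuous \<zeta> \<Longrightarrow> weakly_converges x l \<Longrightarrow> (\<lambda>n. \<zeta> (x n)) \<longlonglongrightarrow> \<zeta> l"
  by (simp add: seq_weakly_continuous_def)

lemma P2w_test_if_bounded:
  assumes "seq_weakly_continuous \<zeta>" "\<And>x. \<bar>\<zeta> x\<bar> \<le> B"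
  shows "\<zeta> \<in> P2w_test"
proof -
  have lim: "filterlim (\<lambda>x::'a. 1 + (norm x)\<^sup>2) at_top at_infinity"
    by (intro filterlim_tendsto_add_at_top[OF tendsto_const] filterlim_pow_at_top
        filterlim_norm_at_top) auto
  have "((\<lambda>x::'a. B / (1 + (norm x)\<^sup>2)) \<longlongrightarrow> 0) at_infinity"
    by (rule tendsto_divide_0[OF tendsto_const filterlim_at_top_imp_at_infinity[OF lim]])
  then have "((\<lambda>x. \<zeta> x / (1 + (norm x)\<^sup>2)) \<longlongrightarrow> 0) at_infinity"
    by (rule Lim_null_comparison[rotated])
      (use assms(2) in \<open>auto simp: abs_divide intro!: always_eventually divide_right_mono\<close>)
  then show ?thesis using assms(1) by (simp add: P2w_test_def)
qed

lemma seq_weakly_continuous_borel: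
  fixes \<zeta> :: "'a::real_inner \<Rightarrow> real"
  assumes "seq_weakly_continuous \<zeta>"
  shows "\<zeta> \<in> borel_measurable borel"
proof (rule borel_measurable_continuous_onI)
  show "continuous_on UNIV \<zeta>"
    unfolding continuous_on_sequentially comp_def
  proof (intro allI ballI impI)
    fix x :: "nat \<Rightarrow> 'a" and a
    assume "(\<forall>n. x n \<in> UNIV) \<and> x \<longlonglongrightarrow> a"
    then have "weakly_converges x a"
      unfolding weakly_converges_def by (intro allI tendsto_inner tendsto_const) simp
    then show "(\<lambda>n. \<zeta> (x n)) \<longlonglongrightarrow> \<zeta> a"
      by (rule seq_weakly_continuous_tendsto[OF assms])
  qed
qed

lemma P2w_test_borel [measurable_dest]:
  "\<zeta> \<in> P2w_test \<Longrightarrow> \<zeta> \<in> borel_measurable borel"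
  by (simp add: P2w_test_def seq_weakly_continuous_borel)

text \<open>Dominated convergence passes the equality of integrals from test functions to indicators
  of polyhedra, which form an intersection-stable generator.\<close>

lemma measure_eqI_P2w_test:
  fixes \<mu> \<nu> :: "'a::{real_inner, second_countable_topology} measure"
  assumes sets [simp, measurable_cong]: "sets \<mu> = sets borel" "sets \<nu> = sets borel"
    and "prob_space \<mu>" "prob_space \<nu>"
    and eq: "\<And>\<zeta>. \<zeta> \<in> P2w_test \<Longrightarrow> (\<integral>x. \<zeta> x \<partial>\<mu>) = (\<integral>x. \<zeta> x \<partial>\<nu>)"
  shows "\<mu> = \<nu>"
proof -
  interpret \<mu>: prob_space \<mu> by fact
  interpret \<nu>: prob_space \<nu> by fact
  have poly: "emeasure \<mu> P = emeasure \<nu> P" if P: "P \<in> polyhedra" for P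
  proof -
    obtain J where J: "finite J" "P = {x. \<forall>(y, c)\<in>J. x \<bullet> y \<le> c}"
      using P unfolding polyhedra_def by blast
    have P' [measurable]: "P \<in> sets borel"
      using P unfolding sets_borel_eq_sigma_polyhedra by blast
    \<comment> \<open>A product of ramps: each factor is 1 on its halfspace and, for
      \<open>m > 0\<close>, has dropped to 0 once the constraint is exceeded by 1/m. Only finitely
      many inner products enter, so \<open>h m\<close> is weakly continuous.\<close>
    define h where "h m x = (\<Prod>p\<in>J. max 0 (1 - real m * max 0 (x \<bullet> fst p - snd p)))" for m x
    have h01: "0 \<le> h m x" "h m x \<le> 1" for m x
      unfolding h_def by (auto intro!: prod_nonneg prod_le_1)
    have "seq_weakly_continuous (h m)" for m
      unfolding seq_weakly_continuous_def h_def
      by (intro allI impI tendsto_prod tendsto_max tendsto_diff tendsto_mult tendsto_const)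
        (simp add: weakly_converges_def)
    then have test: "h m \<in> P2w_test" for m
      by (rule P2w_test_if_bounded[where B = 1]) (use h01 in \<open>simp_all add: abs_of_nonneg\<close>)
    then have [measurable]: "h m \<in> borel_measurable borel" for m by (rule P2w_test_borel)
    have lim: "(\<lambda>m. h m x) \<longlonglongrightarrow> indicator P x" for x
    proof -
      have "(\<lambda>m. max 0 (1 - real m * max 0 (x \<bullet> fst p - snd p))) \<longlonglongrightarrow> (if x \<bullet> fst p \<le> snd p then 1 else 0)" for p
      proof (cases "x \<bullet> fst p \<le> snd p")
        case False
        define t where "t = x \<bullet> fst p - snd p"
        have "t > 0" using False by (simp add: t_def)
        obtain N where N: "1 / t < real N" using reals_Archimedean2 by blast
        have "max 0 (1 - real m * max 0 t) = 0" if "m \<ge> N" for m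
        proof -
          have "1 / t < real m" using N that by linarith
          then show ?thesis using \<open>t > 0\<close> by (simp add: field_simps max_def)
        qed
        then have "\<forall>\<^sub>F m in sequentially. max 0 (1 - real m * max 0 t) = 0"
          unfolding eventually_sequentially by blast
        then show ?thesis using False unfolding t_def by (simp add: tendsto_eventually)
      qed (simp add: max_def)
      then have "(\<lambda>m. h m x) \<longlonglongrightarrow> (\<Prod>p\<in>J. if x \<bullet> fst p \<le> snd p then 1 else 0)"
        unfolding h_def by (rule tendsto_prod)
      also have "(\<Prod>p\<in>J. if x \<bullet> fst p \<le> snd p then 1 else 0) = (indicator P x :: real)"
      proof (cases "x \<in> P")
        case True
        then show ?thesis unfolding J(2) by (auto intro!: prod.neutral)
      next
        case False
        then obtain p where "p \<in> J" "\<not> x \<bullet> fst p \<le> snd p" unfolding J(2) by auto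
        then have "(\<Prod>p\<in>J. if x \<bullet> fst p \<le> snd p then 1 else (0::real)) = 0"
          using J(1) by (intro prod_zero) auto
        then show ?thesis using False by simp
      qed
      finally show ?thesis .
    qed
    have "(\<lambda>m. \<integral>x. h m x \<partial>M) \<longlonglongrightarrow> measure M P" if M: "prob_space M" "sets M = sets borel" for M
    proof -
      interpret prob_space M by fact
      note M(2)[measurable_cong]
      have "(\<lambda>m. \<integral>x. h m x \<partial>M) \<longlonglongrightarrow> (\<integral>x. indicator P x \<partial>M)"
        by (rule integral_dominated_convergence[where w = "\<lambda>_. 1"]) (use lim h01 in auto)
      then show ?thesis using M(2) sets_eq_imp_space_eq[OF M(2)] by simp
    qed
    from this[of \<mu>] this[of \<nu>] have "measure \<mu> P = measure \<nu> P"
      using assms(3,4) eq[OF test] by (auto intro: LIMSEQ_unique)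
    then show ?thesis by (simp add: \<mu>.emeasure_eq_measure \<nu>.emeasure_eq_measure)
  qed
  show ?thesis
  proof (rule measure_eqI_generator_eq[where E = polyhedra and \<Omega> = UNIV and A = "\<lambda>_. UNIV"])
    show "Int_stable (polyhedra :: 'a set set)"
    proof (rule Int_stableI)
      fix P Q :: "'a set" assume "P \<in> polyhedra" "Q \<in> polyhedra"
      then obtain J K where "finite J" "P = {x. \<forall>(y, c)\<in>J. x \<bullet> y \<le> c}"
          "finite K" "Q = {x. \<forall>(y, c)\<in>K. x \<bullet> y \<le> c}"
        unfolding polyhedra_def by blast
      then show "P \<inter> Q \<in> polyhedra"
        unfolding polyhedra_def by (intro image_eqI[of _ _ "J \<union> K"]) auto
    qed
    show "range (\<lambda>_::nat. UNIV) \<subseteq> (polyhedra :: 'a set set)"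
      unfolding polyhedra_def by (auto intro!: image_eqI[of _ _ "{}"])
  qed (auto simp: poly sets_borel_eq_sigma_polyhedra)
qed

section \<open>Skorokhod representation for the weak topology\<close>

lemma liminf_le_const: "(\<And>k. u k \<le> c) \<Longrightarrow> liminf u \<le> c" for c :: ennreal
  by (rule order_trans[OF Liminf_le_Limsup Limsup_bounded]) auto

text \<open>The laws of the codes live on a bounded interval, hence are tight without any assumption
  on \<open>\<mu>\<close>, and the real line theory provides variables \<open>V k\<close> with
  convergent values. Decoding them restores the original laws. The moment bound enters through
  Fatou's lemma, which keeps almost every path from escaping to infinity.\<close>

lemma weak_skorokhod:
  fixes \<mu> :: "nat \<Rightarrow> 'a::{real_inner, complete_space, second_countable_topology} measure"
  assumes sets: "\<And>k. sets (\<mu> k) = sets borel" and prob: "\<And>k. prob_space (\<mu> k)"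
    and bound: "\<And>k. (\<integral>\<^sup>+x. ennreal ((norm x)\<^sup>2) \<partial>\<mu> k) \<le> ennreal C"
  obtains r and \<Omega> :: "real measure" and X Y where "strict_mono (r :: nat \<Rightarrow> nat)" "prob_space \<Omega>"
    "\<And>k. X k \<in> borel_measurable \<Omega>" "\<And>k. distr \<Omega> borel (X k) = \<mu> (r k)"
    "Y \<in> borel_measurable \<Omega>" "AE w in \<Omega>. weakly_converges (\<lambda>k. X k w) (Y w)"
proof -
  note sets[measurable_cong]
  define L where "L k = distr (\<mu> k) borel (code :: 'a \<Rightarrow> real)" for k
  have L: "real_distribution (L k)" for k
    unfolding L_def using prob[of k]
    by (auto intro!: prob_space.real_distribution_distr)
  have "tight L"
    unfolding tight_def
  proof (intro conjI allI impI)
    fix e :: real assume "0 < e"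
    \<comment> \<open>Any half-open interval around [0, 3/2], the range bound of
      \<open>code\<close>, would do.\<close>
    have "measure (L k) {-1<..2} = 1" for k
    proof -
      interpret prob_space "\<mu> k" by (rule prob)
      have "code -` {-1<..2} \<inter> space (\<mu> k) = space (\<mu> k)"
      proof -
        have "code x \<in> {-1<..2}" for x :: 'a
          using code_bounds[of x] unfolding greaterThanAtMost_iff by linarith
        then show ?thesis by auto
      qed
      then show ?thesis unfolding L_def by (subst measure_distr) (auto simp: prob_space)
    qed
    then show "\<exists>a b. a < b \<and> (\<forall>n. 1 - e < measure (L n) {a<..b})"
      using \<open>0 < e\<close> by (intro exI[of _ "-1"] exI[of _ 2]) auto
  qed (rule L)
  then obtain r M where r: "strict_mono r" and M: "real_distribution M" "weak_conv_m (L \<circ> id \<circ> r) M"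
    using tight_imp_convergent_subsubsequence[of L id] strict_mono_id by blast
  obtain \<Omega> :: "real measure" and V :: "nat \<Rightarrow> real \<Rightarrow> real" and V' where \<Omega>: "prob_space \<Omega>"
    and V [measurable]: "\<And>k. V k \<in> borel_measurable \<Omega>" and dV: "\<And>k. distr \<Omega> borel (V k) = L (r k)"
    and lim: "\<And>w. w \<in> space \<Omega> \<Longrightarrow> (\<lambda>k. V k w) \<longlonglongrightarrow> V' w"
    using Skorohod[OF _ M] L unfolding comp_def id_def by blast
  interpret \<Omega>: prob_space \<Omega> by (rule \<Omega>)
  define X where "X k w = (decode (V k w) :: 'a)" for k w
  have X [measurable]: "X k \<in> borel_measurable \<Omega>" for k unfolding X_def by measurable
  have dX: "distr \<Omega> borel (X k) = \<mu> (r k)" for k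
  proof -
    have "distr \<Omega> borel (X k) = distr (distr \<Omega> borel (V k)) borel decode"
      by (subst distr_distr) (auto simp: comp_def X_def[abs_def])
    also have "\<dots> = distr (\<mu> (r k)) borel (\<lambda>x. x)"
      unfolding dV L_def by (subst distr_distr) (auto simp: comp_def)
    also have "\<dots> = \<mu> (r k)" by (rule distr_id2) (simp add: sets)
    finally show ?thesis .
  qed
  \<comment> \<open>\<open>decode\<close> is only a left inverse, so this can fail where
    \<open>V k\<close> is not a code. The law of \<open>V k\<close> is an image under
    \<open>code\<close>, which makes that event null.\<close>
  have "AE w in \<Omega>. code (X k w) = V k w" for k
  proof -
    have "AE y in L (r k). code (decode y :: 'a) = y"
      unfolding L_def by (subst AE_distr_iff) auto
    then show ?thesis unfolding dV[symmetric] X_def by (subst (asm) AE_distr_iff) auto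
  qed
  then have code: "AE w in \<Omega>. \<forall>k. code (X k w) = V k w" by (simp add: AE_all_countable)
  have "AE w in \<Omega>. liminf (\<lambda>k. ennreal ((norm (X k w))\<^sup>2)) \<noteq> \<infinity>"
  proof (rule nn_integral_PInf_AE)
    have "(\<integral>\<^sup>+w. ennreal ((norm (X k w))\<^sup>2) \<partial>\<Omega>) \<le> ennreal C" for k
      using bound[of "r k"] unfolding dX[symmetric] by (subst (asm) nn_integral_distr) auto
    then have "liminf (\<lambda>k. \<integral>\<^sup>+w. ennreal ((norm (X k w))\<^sup>2) \<partial>\<Omega>) \<le> ennreal C"
      by (rule liminf_le_const)
    then have "(\<integral>\<^sup>+w. liminf (\<lambda>k. ennreal ((norm (X k w))\<^sup>2)) \<partial>\<Omega>) \<le> ennreal C"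
      using nn_integral_liminf[of "\<lambda>k w. ennreal ((norm (X k w))\<^sup>2)" \<Omega>] by (auto intro: order_trans)
    then show "(\<integral>\<^sup>+w. liminf (\<lambda>k. ennreal ((norm (X k w))\<^sup>2)) \<partial>\<Omega>) \<noteq> \<infinity>"
      by (auto simp: top_unique)
  qed measurable
  with code AE_space have AE: "AE w in \<Omega>. \<exists>l. weakly_converges (\<lambda>k. X k w) l"
  proof eventually_elim
    case (elim w)
    obtain b where b: "liminf (\<lambda>k. ennreal ((norm (X k w))\<^sup>2)) < ennreal b" "0 \<le> b"
    proof -
      have "liminf (\<lambda>k. ennreal ((norm (X k w))\<^sup>2)) < top" using elim(3) by (simp add: less_top)
      then obtain c where "liminf (\<lambda>k. ennreal ((norm (X k w))\<^sup>2)) < c" "c < top" using dense by blast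
      then show thesis using that by (cases c) auto
    qed
    \<comment> \<open>The bound \<open>b + 1\<close> serves in place of a square root: b <= (b +
      1)^2 for every b >= 0.\<close>
    have "frequently (\<lambda>k. norm (X k w) < b + 1) sequentially"
    proof (rule ccontr)
      assume "\<not> ?thesis"
      then have "\<forall>\<^sub>F k in sequentially. b + 1 \<le> norm (X k w)" by (simp add: frequently_def not_less)
      then have "\<forall>\<^sub>F k in sequentially. ennreal b \<le> ennreal ((norm (X k w))\<^sup>2)"
      proof eventually_elim
        case (elim k)
        have "b \<le> (b + 1)\<^sup>2" using b(2) by (simp add: power2_eq_square algebra_simps)
        also have "\<dots> \<le> (norm (X k w))\<^sup>2" using elim b(2) by (intro power_mono) auto
        finally show ?case by (rule ennreal_leI)
      qed
      then have "ennreal b \<le> liminf (\<lambda>k. ennreal ((norm (X k w))\<^sup>2))" by (rule Liminf_bounded)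
      then show False using b(1) by simp
    qed
    moreover have "(\<lambda>k. code (X k w)) \<longlonglongrightarrow> V' w" using lim[of w] elim by simp
    ultimately show ?case by (metis code_convergent_imp_weakly_convergent)
  qed
  then obtain N where N: "N \<in> null_sets \<Omega>" "{w \<in> space \<Omega>. \<not> (\<exists>l. weakly_converges (\<lambda>k. X k w) l)} \<subseteq> N"
    unfolding eventually_ae_filter by blast
  have [measurable]: "N \<in> sets \<Omega>" using N(1) by auto
  \<comment> \<open>With the value 0 on the null set \<open>N\<close>, the inner products of
    \<open>Y\<close> are limits at every point of measurable functions, namely those of
    \<open>X k\<close> set to 0 on \<open>N\<close>.\<close>
  define Y where "Y w = (if w \<in> N then 0 else SOME l. weakly_converges (\<lambda>k. X k w) l)" for w
  have Y: "weakly_converges (\<lambda>k. X k w) (Y w)" if "w \<in> space \<Omega>" "w \<notin> N" for w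
    using that N(2) someI_ex[of "weakly_converges (\<lambda>k. X k w)"] by (auto simp: Y_def)
  have "Y \<in> borel_measurable \<Omega>"
  proof (rule borel_measurable_if_inner_measurable)
    fix y
    show "(\<lambda>w. Y w \<bullet> y) \<in> borel_measurable \<Omega>"
    proof (rule borel_measurable_LIMSEQ_real)
      show "(\<lambda>k. if w \<in> N then 0 else X k w \<bullet> y) \<longlonglongrightarrow> Y w \<bullet> y" if "w \<in> space \<Omega>" for w
        using Y[OF that] by (cases "w \<in> N") (auto simp: Y_def weakly_converges_def)
    qed measurable
  qed
  moreover have "AE w in \<Omega>. weakly_converges (\<lambda>k. X k w) (Y w)"
    by (rule AE_I'[OF N(1)]) (use Y in auto)
  ultimately show thesis using r \<Omega> X dX by (intro that)
qed

section \<open>Second moments and passage to the limit under integrals\<close>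

lemma P2D:
  assumes "\<mu> \<in> P2"
  shows "sets \<mu> = sets borel" "prob_space \<mu>" "integrable \<mu> (\<lambda>x. (norm x)\<^sup>2)"
  using assms by (auto simp: P2_def)

lemma norm_diff_sq_le: "(norm (x - y))\<^sup>2 \<le> 2 * (norm x)\<^sup>2 + 2 * (norm y)\<^sup>2" for x y :: "'a::real_inner"
proof -
  have "0 \<le> (norm (x + y))\<^sup>2" by simp
  then show ?thesis by (simp add: power2_norm_eq_inner inner_simps inner_commute)
qed

lemma integrable_norm_diff_sq:
  fixes U V :: "'b \<Rightarrow> 'a::{real_inner, second_countable_topology}"
  assumes [measurable]: "U \<in> borel_measurable M" "V \<in> borel_measurable M"
    and "integrable M (\<lambda>w. (norm (U w))\<^sup>2)" "integrable M (\<lambda>w. (norm (V w))\<^sup>2)"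
  shows "integrable M (\<lambda>w. (norm (U w - V w))\<^sup>2)"
proof (rule Bochner_Integration.integrable_bound)
  show "integrable M (\<lambda>w. 2 * (norm (U w))\<^sup>2 + 2 * (norm (V w))\<^sup>2)" using assms by simp
  show "AE w in M. norm ((norm (U w - V w))\<^sup>2) \<le> norm (2 * (norm (U w))\<^sup>2 + 2 * (norm (V w))\<^sup>2)"
    using norm_diff_sq_le by (intro AE_I2) auto
qed measurable

text \<open>Far out the bound is the decay at infinity. On a ball, which need not be norm compact,
  boundedness follows from weak compactness: values tending to infinity would contradict continuity
  along a weakly convergent subsequence.\<close>

lemma P2w_test_growth:
  fixes \<zeta> :: "'a::{real_inner, complete_space, second_countable_topology} \<Rightarrow> real"
  assumes \<zeta>: "\<zeta> \<in> P2w_test" and "0 < e"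
  obtains B where "\<And>x. \<bar>\<zeta> x\<bar> \<le> B + e * (norm x)\<^sup>2"
proof -
  have sw: "seq_weakly_continuous \<zeta>" using \<zeta> by (simp add: P2w_test_def)
  have "((\<lambda>x. \<zeta> x / (1 + (norm x)\<^sup>2)) \<longlongrightarrow> 0) at_infinity" using \<zeta> by (simp add: P2w_test_def)
  then have "\<forall>\<^sub>F x in at_infinity. dist (\<zeta> x / (1 + (norm x)\<^sup>2)) 0 < e"
    using \<open>0 < e\<close> by (rule tendstoD)
  then obtain b where b: "\<And>x :: 'a. b \<le> norm x \<Longrightarrow> \<bar>\<zeta> x / (1 + (norm x)\<^sup>2)\<bar> < e"
    unfolding eventually_at_infinity by auto
  have out: "\<bar>\<zeta> x\<bar> \<le> e + e * (norm x)\<^sup>2" if "b \<le> norm x" for x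
  proof -
    have "0 < 1 + (norm x)\<^sup>2" by (smt (verit) zero_le_power2)
    then show ?thesis using b[OF that] by (simp add: abs_divide divide_less_eq algebra_simps)
  qed
  have "\<exists>D. \<forall>x :: 'a. norm x \<le> b \<longrightarrow> \<bar>\<zeta> x\<bar> \<le> D"
  proof (rule ccontr)
    assume "\<not> ?thesis"
    then have "\<exists>x :: 'a. norm x \<le> b \<and> real n < \<bar>\<zeta> x\<bar>" for n :: nat by (meson not_le)
    then obtain x :: "nat \<Rightarrow> 'a" where x: "\<And>n. norm (x n) \<le> b" "\<And>n. real n < \<bar>\<zeta> (x n)\<bar>" by metis
    obtain r l where r: "strict_mono r" "weakly_converges (x \<circ> r) l"
      using bounded_imp_weakly_convergent_subsequence[of x b] x(1) by blast
    then have "(\<lambda>n. \<zeta> ((x \<circ> r) n)) \<longlonglongrightarrow> \<zeta> l" using seq_weakly_continuous_tendsto[OF sw] by blast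
    then have "Bseq (\<lambda>n. \<zeta> ((x \<circ> r) n))" using convergent_imp_Bseq convergent_def by blast
    then obtain K where K: "\<And>n. \<bar>\<zeta> (x (r n))\<bar> \<le> K" unfolding Bseq_def by auto
    obtain n where "K < real n" using reals_Archimedean2 by blast
    then show False using K[of n] x(2)[of "r n"] seq_suble[OF r(1), of n] by linarith
  qed
  then obtain D where D: "\<And>x. norm x \<le> b \<Longrightarrow> \<bar>\<zeta> x\<bar> \<le> D" by blast
  show thesis
  proof (rule that[of "\<bar>D\<bar> + e"])
    fix x :: 'a
    have "0 \<le> e * (norm x)\<^sup>2" using \<open>0 < e\<close> by simp
    then show "\<bar>\<zeta> x\<bar> \<le> \<bar>D\<bar> + e + e * (norm x)\<^sup>2"
      using out[of x] D[of x] \<open>0 < e\<close> by linarith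
  qed
qed

lemma P2w_test_integrable:
  fixes X :: "'b \<Rightarrow> 'a::{real_inner, complete_space, second_countable_topology}"
  assumes "\<zeta> \<in> P2w_test" and [measurable]: "X \<in> borel_measurable M" and "finite_measure M"
    and int: "integrable M (\<lambda>w. (norm (X w))\<^sup>2)"
  shows "integrable M (\<lambda>w. \<zeta> (X w))"
proof -
  interpret finite_measure M by fact
  note P2w_test_borel[OF assms(1), measurable]
  obtain B where B: "\<And>x. \<bar>\<zeta> x\<bar> \<le> B + 1 * (norm x)\<^sup>2" using P2w_test_growth[OF assms(1) zero_less_one] by blast
  show ?thesis
  proof (rule Bochner_Integration.integrable_bound)
    show "integrable M (\<lambda>w. B + 1 * (norm (X w))\<^sup>2)" using int by simp
    show "AE w in M. norm (\<zeta> (X w)) \<le> norm (B + 1 * (norm (X w))\<^sup>2)"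
      using B by (intro AE_I2) (metis abs_ge_self order_trans real_norm_def)
  qed measurable
qed

text \<open>A substitute for uniform integrability. Cutting \<open>W k\<close> off at
  \<open>G\<close> leaves a dominated sequence, and the excess is at most \<open>e * Q k\<close>,
  whose integral is small uniformly in \<open>k\<close>; \<open>G\<close> may depend on
  \<open>e\<close>.\<close>

lemma integral_tendsto_0_if_almost_dominated:
  fixes W :: "nat \<Rightarrow> 'b \<Rightarrow> real"
  assumes [measurable]: "\<And>k. W k \<in> borel_measurable M"
    and lim: "AE w in M. (\<lambda>k. W k w) \<longlonglongrightarrow> 0"
    and Q: "\<And>k. integrable M (Q k)" "\<And>k. (\<integral>w. Q k w \<partial>M) \<le> C"
    and dom: "\<And>e. 0 < e \<Longrightarrow> \<exists>G. integrable M G \<and> (\<forall>k w. \<bar>W k w\<bar> \<le> G w + e * Q k w)"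
    and Q0: "\<And>k w. 0 \<le> Q k w"
  shows "(\<lambda>k. \<integral>w. W k w \<partial>M) \<longlonglongrightarrow> 0"
proof (rule LIMSEQ_I)
  fix \<epsilon> :: real assume "0 < \<epsilon>"
  have "0 \<le> C" using Q(2)[of 0] Q0 by (meson Bochner_Integration.integral_nonneg order_trans)
  \<comment> \<open>Chosen to make \<open>e * C\<close> less than half of \<open>\<epsilon>\<close>;
    the summand 1 keeps the denominator positive when \<open>C\<close> is 0.\<close>
  define e where "e = \<epsilon> / (2 * (C + 1))"
  have "0 < e" using \<open>0 < \<epsilon>\<close> \<open>0 \<le> C\<close> by (simp add: e_def)
  have eC: "e * C < \<epsilon> / 2" using \<open>0 < \<epsilon>\<close> \<open>0 \<le> C\<close> by (simp add: e_def field_simps)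
  obtain G where G: "integrable M G" "\<And>k w. \<bar>W k w\<bar> \<le> G w + e * Q k w" using dom[OF \<open>0 < e\<close>] by blast
  have [measurable]: "G \<in> borel_measurable M" using G(1) by auto
  define m where "m k w = min \<bar>W k w\<bar> \<bar>G w\<bar>" for k w
  have m [measurable]: "m k \<in> borel_measurable M" for k unfolding m_def by measurable
  have mi: "integrable M (m k)" for k
    by (rule Bochner_Integration.integrable_bound[OF G(1)]) (auto simp: m_def)
  have "(\<lambda>k. \<integral>w. m k w \<partial>M) \<longlonglongrightarrow> (\<integral>w. 0 \<partial>M)"
  proof (rule integral_dominated_convergence[where w = "\<lambda>w. \<bar>G w\<bar>"])
    show "AE w in M. (\<lambda>k. m k w) \<longlonglongrightarrow> 0"
      using lim
    proof eventually_elim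
      case (elim w)
      have "(\<lambda>k. min \<bar>W k w\<bar> \<bar>G w\<bar>) \<longlonglongrightarrow> min \<bar>0\<bar> \<bar>G w\<bar>"
        by (intro tendsto_min tendsto_rabs tendsto_const elim)
      then show ?case by (simp add: m_def)
    qed
  qed (use G(1) in \<open>auto simp: m_def\<close>)
  then have "(\<lambda>k. \<integral>w. m k w \<partial>M) \<longlonglongrightarrow> 0" by simp
  then obtain N where N: "\<And>k. k \<ge> N \<Longrightarrow> \<bar>\<integral>w. m k w \<partial>M\<bar> < \<epsilon> / 2"
    using LIMSEQ_D[of _ 0 "\<epsilon> / 2"] \<open>0 < \<epsilon>\<close> by fastforce
  have "\<bar>\<integral>w. W k w \<partial>M\<bar> < \<epsilon>" if "k \<ge> N" for k
  proof -
    have le: "\<bar>W k w\<bar> \<le> m k w + e * Q k w" for w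
      using G(2)[of k w] Q0[of k w] \<open>0 < e\<close> by (auto simp: m_def min_def abs_if mult_nonneg_nonneg)
    have dom: "integrable M (\<lambda>w. m k w + e * Q k w)" using mi Q(1) by simp
    have "integrable M (W k)"
      by (rule Bochner_Integration.integrable_bound[OF dom])
        (use le in \<open>auto intro: order_trans[OF _ abs_ge_self]\<close>)
    then have "(\<integral>w. \<bar>W k w\<bar> \<partial>M) \<le> (\<integral>w. m k w + e * Q k w \<partial>M)"
      by (intro integral_mono dom le) simp
    then have "\<bar>\<integral>w. W k w \<partial>M\<bar> \<le> (\<integral>w. m k w + e * Q k w \<partial>M)"
      by (rule order_trans[OF integral_abs_bound])
    also have "\<dots> = (\<integral>w. m k w \<partial>M) + e * (\<integral>w. Q k w \<partial>M)" using mi Q by simp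
    also have "\<dots> \<le> (\<integral>w. m k w \<partial>M) + e * C" using Q(2)[of k] \<open>0 < e\<close> by simp
    also have "\<dots> < \<epsilon>" using N[OF that] eC by linarith
    finally show ?thesis .
  qed
  then show "\<exists>N. \<forall>k\<ge>N. norm ((\<integral>w. W k w \<partial>M) - 0) < \<epsilon>" by auto
qed

text \<open>The outcome of the Skorokhod representation for bounded second moments. Opial's property
  uses it three times: for the pairs and for each of their coordinates.\<close>

locale weakly_convergent_L2 = prob_space M for M :: "'b measure" +
  fixes X :: "nat \<Rightarrow> 'b \<Rightarrow> 'a::{real_inner, complete_space, second_countable_topology}" and Y :: "'b \<Rightarrow> 'a" and C :: real
  assumes X [measurable]: "\<And>k. X k \<in> borel_measurable M" and Y [measurable]: "Y \<in> borel_measurable M"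
    and weakly: "AE w in M. weakly_converges (\<lambda>k. X k w) (Y w)"
    and X_int: "\<And>k. integrable M (\<lambda>w. (norm (X k w))\<^sup>2)"
    and X_bound: "\<And>k. (\<integral>w. (norm (X k w))\<^sup>2 \<partial>M) \<le> C"
begin

lemma C_nonneg: "0 \<le> C"
  using X_bound[of 0] by (meson Bochner_Integration.integral_nonneg order_trans zero_le_power2)

text \<open>The squared norm is weakly lower semicontinuous, because it dominates 2 (x . y) - |y|^2
  for fixed y, with equality at x = y. Fatou's lemma does the rest.\<close>

lemma nn_integral_limit_le: "(\<integral>\<^sup>+w. ennreal ((norm (Y w))\<^sup>2) \<partial>M) \<le> ennreal C"
proof -
  have "AE w in M. ennreal ((norm (Y w))\<^sup>2) \<le> liminf (\<lambda>k. ennreal ((norm (X k w))\<^sup>2))"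
    using weakly
  proof eventually_elim
    case (elim w)
    have le: "2 * (X k w \<bullet> Y w) - (norm (Y w))\<^sup>2 \<le> (norm (X k w))\<^sup>2" for k
    proof -
      have "0 \<le> (norm (X k w - Y w))\<^sup>2" by simp
      then show ?thesis by (simp add: power2_norm_eq_inner inner_simps inner_commute)
    qed
    have "(\<lambda>k. 2 * (X k w \<bullet> Y w) - (norm (Y w))\<^sup>2) \<longlonglongrightarrow> 2 * (Y w \<bullet> Y w) - (norm (Y w))\<^sup>2"
      using elim unfolding weakly_converges_def by (intro tendsto_diff tendsto_mult tendsto_const) auto
    then have "(\<lambda>k. ennreal (2 * (X k w \<bullet> Y w) - (norm (Y w))\<^sup>2)) \<longlonglongrightarrow> ennreal ((norm (Y w))\<^sup>2)"
      by (intro tendsto_ennrealI) (simp add: power2_norm_eq_inner)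
    then have "ennreal ((norm (Y w))\<^sup>2) = liminf (\<lambda>k. ennreal (2 * (X k w \<bullet> Y w) - (norm (Y w))\<^sup>2))"
      by (intro lim_imp_Liminf[symmetric]) simp_all
    also have "\<dots> \<le> liminf (\<lambda>k. ennreal ((norm (X k w))\<^sup>2))"
      by (intro Liminf_mono always_eventually allI ennreal_leI le)
    finally show ?case .
  qed
  then have "(\<integral>\<^sup>+w. ennreal ((norm (Y w))\<^sup>2) \<partial>M) \<le> (\<integral>\<^sup>+w. liminf (\<lambda>k. ennreal ((norm (X k w))\<^sup>2)) \<partial>M)"
    by (rule nn_integral_mono_AE)
  also have "\<dots> \<le> liminf (\<lambda>k. \<integral>\<^sup>+w. ennreal ((norm (X k w))\<^sup>2) \<partial>M)"
    by (rule nn_integral_liminf) measurable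
  also have "\<dots> = liminf (\<lambda>k. ennreal (\<integral>w. (norm (X k w))\<^sup>2 \<partial>M))"
    using X_int by (subst nn_integral_eq_integral) auto
  also have "\<dots> \<le> ennreal C"
    by (intro liminf_le_const ennreal_leI X_bound)
  finally show ?thesis .
qed

lemma Y_int: "integrable M (\<lambda>w. (norm (Y w))\<^sup>2)"
  using nn_integral_limit_le by (intro integrableI_bounded) (auto simp: le_less_trans)

lemma inner_int:
  assumes [measurable]: "U \<in> borel_measurable M" "V \<in> borel_measurable M"
    and "integrable M (\<lambda>w. (norm (U w :: 'a))\<^sup>2)" "integrable M (\<lambda>w. (norm (V w))\<^sup>2)"
  shows "integrable M (\<lambda>w. U w \<bullet> V w)"
proof (rule Bochner_Integration.integrable_bound)
  show "integrable M (\<lambda>w. (norm (U w))\<^sup>2 + (norm (V w))\<^sup>2)" using assms by simp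
  have "\<bar>U w \<bullet> V w\<bar> \<le> (norm (U w))\<^sup>2 + (norm (V w))\<^sup>2" for w
  proof -
    have "\<bar>U w \<bullet> V w\<bar> \<le> norm (U w) * norm (V w)" by (rule Cauchy_Schwarz_ineq2)
    moreover have "0 \<le> (norm (U w) - norm (V w))\<^sup>2" by simp
    moreover have "0 \<le> norm (U w) * norm (V w)" by simp
    ultimately show ?thesis unfolding power2_diff by linarith
  qed
  then show "AE w in M. norm (U w \<bullet> V w) \<le> norm ((norm (U w))\<^sup>2 + (norm (V w))\<^sup>2)"
    by (intro AE_I2) simp
qed measurable

lemma diff_bound:
  "integrable M (\<lambda>w. (norm (X k w - Y w))\<^sup>2)" (is ?int)
  "(\<integral>w. (norm (X k w - Y w))\<^sup>2 \<partial>M) \<le> 4 * C" (is ?bd)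
proof -
  show int: ?int by (rule integrable_norm_diff_sq[OF X Y X_int Y_int])
  have "(\<integral>w. (norm (X k w - Y w))\<^sup>2 \<partial>M) \<le> (\<integral>w. 2 * (norm (X k w))\<^sup>2 + 2 * (norm (Y w))\<^sup>2 \<partial>M)"
    by (rule integral_mono[OF int _ norm_diff_sq_le]) (use X_int Y_int in simp)
  also have "\<dots> = 2 * (\<integral>w. (norm (X k w))\<^sup>2 \<partial>M) + 2 * (\<integral>w. (norm (Y w))\<^sup>2 \<partial>M)"
    using X_int Y_int by simp
  also have "(\<integral>w. (norm (Y w))\<^sup>2 \<partial>M) \<le> C"
    using nn_integral_limit_le Y_int C_nonneg by (subst (asm) nn_integral_eq_integral) auto
  finally show ?bd using X_bound[of k] by linarith
qed

text \<open>Almost sure weak convergence and bounded second moments thus give weak convergence in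
  the space of square-integrable maps.\<close>

lemma integral_inner_tendsto:
  assumes Z [measurable]: "Z \<in> borel_measurable M" and Z_int: "integrable M (\<lambda>w. (norm (Z w))\<^sup>2)"
  shows "(\<lambda>k. \<integral>w. X k w \<bullet> Z w \<partial>M) \<longlonglongrightarrow> (\<integral>w. Y w \<bullet> Z w \<partial>M)"
proof -
  have "(\<lambda>k. \<integral>w. (X k w - Y w) \<bullet> Z w \<partial>M) \<longlonglongrightarrow> 0"
  proof (rule integral_tendsto_0_if_almost_dominated[where Q = "\<lambda>k w. (norm (X k w - Y w))\<^sup>2" and C = "4 * C"])
    show "AE w in M. (\<lambda>k. (X k w - Y w) \<bullet> Z w) \<longlonglongrightarrow> 0"
      using weakly
    proof eventually_elim
      case (elim w)
      then have "(\<lambda>k. X k w \<bullet> Z w) \<longlonglongrightarrow> Y w \<bullet> Z w" by (simp add: weakly_converges_def)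
      then show ?case unfolding inner_diff_left by (rule LIM_zero)
    qed
    show "\<exists>G. integrable M G \<and> (\<forall>k w. \<bar>(X k w - Y w) \<bullet> Z w\<bar> \<le> G w + e * (norm (X k w - Y w))\<^sup>2)"
      if "0 < e" for e
    \<comment> \<open>Young's inequality p q <= q^2 / (4 e) + e p^2 splits off a fixed integrable
      majorant.\<close>
    proof (intro exI[of _ "\<lambda>w. (norm (Z w))\<^sup>2 / (4 * e)"] conjI allI)
      show "integrable M (\<lambda>w. (norm (Z w))\<^sup>2 / (4 * e))" using Z_int by simp
      fix k w
      have "\<bar>(X k w - Y w) \<bullet> Z w\<bar> \<le> norm (X k w - Y w) * norm (Z w)" by (rule Cauchy_Schwarz_ineq2)
      also have "\<dots> \<le> (norm (Z w))\<^sup>2 / (4 * e) + e * (norm (X k w - Y w))\<^sup>2"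
      proof -
        have "0 \<le> (2 * e * norm (X k w - Y w) - norm (Z w))\<^sup>2" by simp
        then show ?thesis using \<open>0 < e\<close> by (simp add: field_simps power2_eq_square)
      qed
      finally show "\<bar>(X k w - Y w) \<bullet> Z w\<bar> \<le> (norm (Z w))\<^sup>2 / (4 * e) + e * (norm (X k w - Y w))\<^sup>2" .
    qed
  qed (use diff_bound in auto)
  moreover have "(\<integral>w. (X k w - Y w) \<bullet> Z w \<partial>M) = (\<integral>w. X k w \<bullet> Z w \<partial>M) - (\<integral>w. Y w \<bullet> Z w \<partial>M)" for k
    using inner_int[OF X Z X_int Z_int] inner_int[OF Y Z Y_int Z_int] by (simp add: inner_diff_left)
  ultimately show ?thesis by (simp add: LIM_zero_iff)
qed

text \<open>Here growth strictly below quadratic is decisive: a test function is bounded by a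
  constant plus an arbitrarily small multiple of the squared norm, which makes the sequence almost
  dominated.\<close>

lemma integral_test_tendsto:
  assumes \<zeta>: "\<zeta> \<in> P2w_test"
  shows "(\<lambda>k. \<integral>w. \<zeta> (X k w) \<partial>M) \<longlonglongrightarrow> (\<integral>w. \<zeta> (Y w) \<partial>M)"
proof -
  note P2w_test_borel[OF \<zeta>, measurable]
  have \<zeta>X: "integrable M (\<lambda>w. \<zeta> (X k w))" for k
    by (rule P2w_test_integrable[OF \<zeta> X finite_measure_axioms X_int])
  have \<zeta>Y: "integrable M (\<lambda>w. \<zeta> (Y w))"
    by (rule P2w_test_integrable[OF \<zeta> Y finite_measure_axioms Y_int])
  have "(\<lambda>k. \<integral>w. \<zeta> (X k w) - \<zeta> (Y w) \<partial>M) \<longlonglongrightarrow> 0"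
  proof (rule integral_tendsto_0_if_almost_dominated[where Q = "\<lambda>k w. (norm (X k w))\<^sup>2" and C = C])
    show "AE w in M. (\<lambda>k. \<zeta> (X k w) - \<zeta> (Y w)) \<longlonglongrightarrow> 0"
      using weakly
    proof eventually_elim
      case (elim w)
      then have "(\<lambda>k. \<zeta> (X k w)) \<longlonglongrightarrow> \<zeta> (Y w)"
        using \<zeta> by (intro seq_weakly_continuous_tendsto) (simp_all add: P2w_test_def)
      then show ?case by (rule LIM_zero)
    qed
    show "\<exists>G. integrable M G \<and> (\<forall>k w. \<bar>\<zeta> (X k w) - \<zeta> (Y w)\<bar> \<le> G w + e * (norm (X k w))\<^sup>2)"
      if "0 < e" for e
    proof -
      obtain B where B: "\<And>x. \<bar>\<zeta> x\<bar> \<le> B + e * (norm x)\<^sup>2" using P2w_test_growth[OF \<zeta> \<open>0 < e\<close>] by blast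
      have "\<bar>\<zeta> (X k w) - \<zeta> (Y w)\<bar> \<le> (B + \<bar>\<zeta> (Y w)\<bar>) + e * (norm (X k w))\<^sup>2" for k w
        using B[of "X k w"] by linarith
      then show ?thesis using \<zeta>Y by (intro exI[of _ "\<lambda>w. B + \<bar>\<zeta> (Y w)\<bar>"]) auto
    qed
  qed (use X_int X_bound in auto)
  then show ?thesis using \<zeta>X \<zeta>Y by (simp add: LIM_zero_iff)
qed

end

lemma weak_skorokhod_L2:
  fixes \<mu> :: "nat \<Rightarrow> 'a::{real_inner, complete_space, second_countable_topology} measure"
  assumes \<mu>: "\<And>k. \<mu> k \<in> P2" and bound: "\<And>k. (\<integral>x. (norm x)\<^sup>2 \<partial>\<mu> k) \<le> C"
  obtains r and \<Omega> :: "real measure" and X Y where "strict_mono (r :: nat \<Rightarrow> nat)"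
    "weakly_convergent_L2 \<Omega> X Y C" "\<And>k. distr \<Omega> borel (X k) = \<mu> (r k)"
proof -
  have sets: "sets (\<mu> k) = sets borel" and prob: "prob_space (\<mu> k)"
    and int: "integrable (\<mu> k) (\<lambda>x. (norm x)\<^sup>2)" for k
    using \<mu>[of k] by (auto simp: P2_def)
  have "(\<integral>\<^sup>+x. ennreal ((norm x)\<^sup>2) \<partial>\<mu> k) \<le> ennreal C" for k
    using bound[of k] int[of k] by (subst nn_integral_eq_integral) (auto intro: ennreal_leI)
  then obtain r and \<Omega> :: "real measure" and X Y where r: "strict_mono (r :: nat \<Rightarrow> nat)" "prob_space \<Omega>"
    "\<And>k. X k \<in> borel_measurable \<Omega>" "\<And>k. distr \<Omega> borel (X k) = \<mu> (r k)"
    "Y \<in> borel_measurable \<Omega>" "AE w in \<Omega>. weakly_converges (\<lambda>k. X k w) (Y w)"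
    using weak_skorokhod[of \<mu> C] sets prob by blast
  note r(3)[measurable]
  have "weakly_convergent_L2 \<Omega> X Y C"
  proof (intro weakly_convergent_L2.intro weakly_convergent_L2_axioms.intro)
    fix k
    show "integrable \<Omega> (\<lambda>w. (norm (X k w))\<^sup>2)"
      using int[of "r k"] unfolding r(4)[symmetric] by (subst (asm) integrable_distr_eq) auto
    show "(\<integral>w. (norm (X k w))\<^sup>2 \<partial>\<Omega>) \<le> C"
      using bound[of "r k"] unfolding r(4)[symmetric] by (subst (asm) integral_distr) auto
  qed (use r in auto)
  with r show thesis by (intro that)
qed

lemma distr_in_P2:
  assumes "prob_space M" and [measurable]: "Y \<in> borel_measurable M" and "integrable M (\<lambda>w. (norm (Y w :: 'a::{real_inner, second_countable_topology}))\<^sup>2)"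
  shows "distr M borel Y \<in> P2"
  using assms by (auto simp: P2_def integrable_distr_eq intro!: prob_space.prob_space_distr)

text \<open>The limit measure is the law of the weak limit \<open>Y\<close>; Fatou's lemma has
  already put it into \<open>P2\<close>.\<close>

lemma P2w_test_compactness:
  fixes \<mu> :: "nat \<Rightarrow> 'a::{real_inner, complete_space, second_countable_topology} measure"
  assumes "\<And>k. \<mu> k \<in> P2" and "\<And>k. (\<integral>x. (norm x)\<^sup>2 \<partial>\<mu> k) \<le> C"
  obtains r \<nu> where "strict_mono (r :: nat \<Rightarrow> nat)" "\<nu> \<in> P2"
    "\<And>\<zeta>. \<zeta> \<in> P2w_test \<Longrightarrow> (\<lambda>k. \<integral>x. \<zeta> x \<partial>\<mu> (r k)) \<longlonglongrightarrow> (\<integral>x. \<zeta> x \<partial>\<nu>)"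
proof -
  obtain r and \<Omega> :: "real measure" and X Y where r: "strict_mono (r :: nat \<Rightarrow> nat)"
    "weakly_convergent_L2 \<Omega> X Y C" "\<And>k. distr \<Omega> borel (X k) = \<mu> (r k)"
    using weak_skorokhod_L2[of \<mu> C] assms by blast
  interpret weakly_convergent_L2 \<Omega> X Y C by (rule r(2))
  have "distr \<Omega> borel Y \<in> P2" by (rule distr_in_P2[OF prob_space_axioms Y Y_int])
  moreover have "(\<lambda>k. \<integral>x. \<zeta> x \<partial>\<mu> (r k)) \<longlonglongrightarrow> (\<integral>x. \<zeta> x \<partial>distr \<Omega> borel Y)" if "\<zeta> \<in> P2w_test" for \<zeta>
  proof -
    note P2w_test_borel[OF that, measurable]
    show ?thesis
      unfolding r(3)[symmetric] using integral_test_tendsto[OF that] by (simp add: integral_distr)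
  qed
  ultimately show thesis using r(1) by (intro that)
qed

section \<open>The Wasserstein distance\<close>

lemma plansD:
  assumes "\<gamma> \<in> plans \<mu> \<nu>"
  shows "sets \<gamma> = sets borel" "prob_space \<gamma>" "distr \<gamma> borel fst = \<mu>" "distr \<gamma> borel snd = \<nu>"
  using assms by (auto simp: plans_def)

lemma coupling_in_plans:
  fixes U V :: "'b \<Rightarrow> 'a::{real_inner, second_countable_topology}"
  assumes "prob_space M" and [measurable]: "U \<in> borel_measurable M" "V \<in> borel_measurable M"
  shows "distr M borel (\<lambda>w. (U w, V w)) \<in> plans (distr M borel U) (distr M borel V)"
proof -
  interpret prob_space M by fact
  have [measurable]: "(\<lambda>w. (U w, V w)) \<in> borel_measurable M" by (simp add: borel_prod[symmetric])
  have [measurable]: "fst \<in> borel_measurable (borel :: ('a \<times> 'a) measure)"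
    "snd \<in> borel_measurable (borel :: ('a \<times> 'a) measure)" by (simp_all add: borel_prod[symmetric])
  show ?thesis
    unfolding plans_def by (auto simp: distr_distr comp_def prob_space_distr)
qed

lemma W2_sq: "(W2 \<mu> \<nu>)\<^sup>2 = enn2real (INF \<gamma>\<in>plans \<mu> \<nu>. \<integral>\<^sup>+ z. ennreal ((norm (fst z - snd z))\<^sup>2) \<partial>\<gamma>)"
  by (simp add: W2_def)

lemma W2_nonneg [simp]: "0 \<le> W2 \<mu> \<nu>"
  by (simp add: W2_def)

lemma W2_le_coupling:
  fixes U V :: "'b \<Rightarrow> 'a::{real_inner, second_countable_topology}"
  assumes "prob_space M" and [measurable]: "U \<in> borel_measurable M" "V \<in> borel_measurable M"
    and U: "integrable M (\<lambda>w. (norm (U w))\<^sup>2)" and V: "integrable M (\<lambda>w. (norm (V w))\<^sup>2)"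
  shows "(W2 (distr M borel U) (distr M borel V))\<^sup>2 \<le> (\<integral>w. (norm (U w - V w))\<^sup>2 \<partial>M)"
proof -
  have [measurable]: "(\<lambda>w. (U w, V w)) \<in> borel_measurable M" by (simp add: borel_prod[symmetric])
  have [measurable]: "fst \<in> borel_measurable (borel :: ('a \<times> 'a) measure)"
    "snd \<in> borel_measurable (borel :: ('a \<times> 'a) measure)" by (simp_all add: borel_prod[symmetric])
  let ?c = "\<lambda>z. ennreal ((norm (fst z - snd z :: 'a))\<^sup>2)"
  have "(INF \<gamma>\<in>plans (distr M borel U) (distr M borel V). \<integral>\<^sup>+ z. ?c z \<partial>\<gamma>) \<le> (\<integral>\<^sup>+ z. ?c z \<partial>distr M borel (\<lambda>w. (U w, V w)))"
    by (rule INF_lower[OF coupling_in_plans]) (use assms in auto)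
  also have "\<dots> = (\<integral>\<^sup>+ w. ennreal ((norm (U w - V w))\<^sup>2) \<partial>M)"
    by (subst nn_integral_distr) auto
  also have "\<dots> = ennreal (\<integral>w. (norm (U w - V w))\<^sup>2 \<partial>M)"
    by (rule nn_integral_eq_integral) (use integrable_norm_diff_sq[OF assms(2-5)] in auto)
  finally show ?thesis unfolding W2_sq by (intro enn2real_leI) auto
qed

lemma plans_integrable:
  fixes \<gamma> :: "('a::{real_inner, second_countable_topology} \<times> 'a) measure"
  assumes \<gamma>: "\<gamma> \<in> plans \<mu> \<nu>" and "\<mu> \<in> P2" "\<nu> \<in> P2"
  shows "fst \<in> borel_measurable \<gamma>" "snd \<in> borel_measurable \<gamma>"
    "integrable \<gamma> (\<lambda>z. (norm (fst z))\<^sup>2)" "integrable \<gamma> (\<lambda>z. (norm (snd z))\<^sup>2)"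
    "integrable \<gamma> (\<lambda>z. (norm (fst z - snd z))\<^sup>2)"
    "(\<integral>z. (norm (fst z))\<^sup>2 \<partial>\<gamma>) = (\<integral>x. (norm x)\<^sup>2 \<partial>\<mu>)" "(\<integral>z. (norm (snd z))\<^sup>2 \<partial>\<gamma>) = (\<integral>x. (norm x)\<^sup>2 \<partial>\<nu>)"
proof -
  note plansD(1)[OF \<gamma>, measurable_cong]
  show [measurable]: "fst \<in> borel_measurable \<gamma>" "snd \<in> borel_measurable \<gamma>"
    by (simp_all add: measurable_cong_sets[OF plansD(1)[OF \<gamma>] refl] borel_prod[symmetric])
  show i: "integrable \<gamma> (\<lambda>z. (norm (fst z))\<^sup>2)"
    using P2D(3)[OF assms(2)] unfolding plansD(3)[OF \<gamma>, symmetric] by (subst (asm) integrable_distr_eq) auto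
  show j: "integrable \<gamma> (\<lambda>z. (norm (snd z))\<^sup>2)"
    using P2D(3)[OF assms(3)] unfolding plansD(4)[OF \<gamma>, symmetric] by (subst (asm) integrable_distr_eq) auto
  show "integrable \<gamma> (\<lambda>z. (norm (fst z - snd z))\<^sup>2)"
    by (rule integrable_norm_diff_sq) (use i j in auto)
  show "(\<integral>z. (norm (fst z))\<^sup>2 \<partial>\<gamma>) = (\<integral>x. (norm x)\<^sup>2 \<partial>\<mu>)"
    unfolding plansD(3)[OF \<gamma>, symmetric] by (subst integral_distr) auto
  show "(\<integral>z. (norm (snd z))\<^sup>2 \<partial>\<gamma>) = (\<integral>x. (norm x)\<^sup>2 \<partial>\<nu>)"
    unfolding plansD(4)[OF \<gamma>, symmetric] by (subst integral_distr) auto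
qed

text \<open>This plan shows that the infimum defining \<open>W2\<close> is finite, so that
  \<open>enn2real\<close> preserves it.\<close>

lemma product_in_plans:
  fixes \<mu> \<nu> :: "'a::{real_inner, second_countable_topology} measure"
  assumes "\<mu> \<in> P2" "\<nu> \<in> P2"
  shows "\<mu> \<Otimes>\<^sub>M \<nu> \<in> plans \<mu> \<nu>"
proof -
  interpret \<mu>: prob_space \<mu> by (rule P2D(2)[OF assms(1)])
  interpret \<nu>: prob_space \<nu> by (rule P2D(2)[OF assms(2)])
  interpret pair_prob_space \<mu> \<nu> ..
  have sets: "sets (\<mu> \<Otimes>\<^sub>M \<nu>) = sets borel"
    unfolding borel_prod[symmetric] by (rule sets_pair_measure_cong[OF P2D(1)[OF assms(1)] P2D(1)[OF assms(2)]])
  have sp: "space \<mu> = UNIV" "space \<nu> = UNIV"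
    using P2D(1)[OF assms(1)] P2D(1)[OF assms(2)] by (auto dest: sets_eq_imp_space_eq)
  have [measurable]: "fst \<in> borel_measurable (borel :: ('a \<times> 'a) measure)"
    "snd \<in> borel_measurable (borel :: ('a \<times> 'a) measure)" by (simp_all add: borel_prod[symmetric])
  note sets[measurable_cong] P2D(1)[OF assms(1), measurable_cong] P2D(1)[OF assms(2), measurable_cong]
  have "distr (\<mu> \<Otimes>\<^sub>M \<nu>) borel fst = \<mu>"
  proof (rule measure_eqI)
    fix A assume "A \<in> sets (distr (\<mu> \<Otimes>\<^sub>M \<nu>) borel fst)"
    then have A: "A \<in> sets borel" by simp
    have "emeasure (distr (\<mu> \<Otimes>\<^sub>M \<nu>) borel fst) A = emeasure (\<mu> \<Otimes>\<^sub>M \<nu>) (A \<times> UNIV)"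
      using A by (subst emeasure_distr) (auto simp: space_pair_measure sp intro!: arg_cong[where f = "emeasure (\<mu> \<Otimes>\<^sub>M \<nu>)"])
    also have "\<dots> = emeasure \<mu> A"
      using A \<nu>.emeasure_space_1 by (subst \<nu>.emeasure_pair_measure_Times) (auto simp: P2D(1)[OF assms(1)] P2D(1)[OF assms(2)] sp)
    finally show "emeasure (distr (\<mu> \<Otimes>\<^sub>M \<nu>) borel fst) A = emeasure \<mu> A" .
  qed (simp add: P2D(1)[OF assms(1)])
  moreover have "distr (\<mu> \<Otimes>\<^sub>M \<nu>) borel snd = \<nu>"
  proof (rule measure_eqI)
    fix A assume "A \<in> sets (distr (\<mu> \<Otimes>\<^sub>M \<nu>) borel snd)"
    then have A: "A \<in> sets borel" by simp
    have "emeasure (distr (\<mu> \<Otimes>\<^sub>M \<nu>) borel snd) A = emeasure (\<mu> \<Otimes>\<^sub>M \<nu>) (UNIV \<times> A)"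
      using A by (subst emeasure_distr) (auto simp: space_pair_measure sp intro!: arg_cong[where f = "emeasure (\<mu> \<Otimes>\<^sub>M \<nu>)"])
    also have "\<dots> = emeasure \<nu> A"
      using A \<mu>.emeasure_space_1 by (subst \<nu>.emeasure_pair_measure_Times) (auto simp: P2D(1)[OF assms(1)] P2D(1)[OF assms(2)] sp)
    finally show "emeasure (distr (\<mu> \<Otimes>\<^sub>M \<nu>) borel snd) A = emeasure \<nu> A" .
  qed (simp add: P2D(1)[OF assms(2)])
  ultimately show ?thesis unfolding plans_def using sets prob_space_axioms by simp
qed

text \<open>All later arguments tolerate a small excess cost, so they take plans from here and work
  with the infimum alone.\<close>

lemma near_optimal_plan:
  fixes \<mu> \<nu> :: "'a::{real_inner, second_countable_topology} measure"
  assumes "\<mu> \<in> P2" "\<nu> \<in> P2" and "(W2 \<mu> \<nu>)\<^sup>2 < c"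
  obtains \<gamma> where "\<gamma> \<in> plans \<mu> \<nu>" "(\<integral>z. (norm (fst z - snd z))\<^sup>2 \<partial>\<gamma>) < c"
proof -
  let ?c = "\<lambda>\<gamma>. \<integral>\<^sup>+ z. ennreal ((norm (fst z - snd z))\<^sup>2) \<partial>\<gamma>"
  let ?I = "INF \<gamma>\<in>plans \<mu> \<nu>. ?c \<gamma>"
  have cost: "?c \<gamma> = ennreal (\<integral>z. (norm (fst z - snd z))\<^sup>2 \<partial>\<gamma>)" if "\<gamma> \<in> plans \<mu> \<nu>" for \<gamma>
    using plans_integrable(5)[OF that assms(1,2)] by (rule nn_integral_eq_integral) simp
  have "?I \<le> ?c (\<mu> \<Otimes>\<^sub>M \<nu>)" by (rule INF_lower[OF product_in_plans[OF assms(1,2)]])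
  also have "\<dots> < top" unfolding cost[OF product_in_plans[OF assms(1,2)]] by simp
  finally have "?I = ennreal ((W2 \<mu> \<nu>)\<^sup>2)" unfolding W2_sq by simp
  also have "\<dots> < ennreal c" using assms(3) by (intro ennreal_lessI) (auto intro: le_less_trans[OF zero_le_power2])
  finally obtain \<gamma> where "\<gamma> \<in> plans \<mu> \<nu>" "?c \<gamma> < ennreal c" by (auto simp: INF_less_iff)
  then show thesis using that[of \<gamma>] unfolding cost[OF \<open>\<gamma> \<in> plans \<mu> \<nu>\<close>] by (simp add: ennreal_less_iff)
qed

section \<open>Approximate gluing of plans and the triangle inequality\<close>

lemma same_cell_density:
  assumes "prob_space \<nu>" and c [measurable]: "c \<in> measurable \<nu> (count_space (UNIV :: nat set))"
  shows "AE x in \<nu>. (\<integral>\<^sup>+y. (if c x = c y then ennreal (1 / measure \<nu> {z \<in> space \<nu>. c z = c x}) else 0) \<partial>\<nu>) = 1"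
proof -
  interpret prob_space \<nu> by fact
  define w where "w i = measure \<nu> {z \<in> space \<nu>. c z = i}" for i
  \<comment> \<open>In a cell of measure 0 the density would be 1/0, that is 0, with the wrong
    integral. There are countably many cells, so the null ones can be discarded together.\<close>
  have "AE x in \<nu>. w i = 0 \<longrightarrow> c x \<noteq> i" for i
  proof (cases "w i = 0")
    case True
    then have "{z \<in> space \<nu>. c z = i} \<in> null_sets \<nu>"
      by (intro null_setsI) (auto simp: w_def emeasure_eq_measure)
    then have "AE x in \<nu>. x \<notin> {z \<in> space \<nu>. c z = i}" by (rule AE_not_in)
    then show ?thesis using AE_space by eventually_elim auto
  qed simp
  then have "AE x in \<nu>. \<forall>i. w i = 0 \<longrightarrow> c x \<noteq> i" by (simp add: AE_all_countable)
  then show ?thesis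
  proof eventually_elim
    case (elim x)
    then have wx: "w (c x) > 0" using measure_nonneg[of \<nu>] by (auto simp: w_def less_le)
    have "(\<integral>\<^sup>+y. (if c x = c y then ennreal (1 / w (c x)) else 0) \<partial>\<nu>) =
        (\<integral>\<^sup>+y. ennreal (1 / w (c x)) * indicator {z \<in> space \<nu>. c z = c x} y \<partial>\<nu>)"
      by (rule nn_integral_cong) (auto simp: indicator_def)
    also have "\<dots> = ennreal (1 / w (c x)) * emeasure \<nu> {z \<in> space \<nu>. c z = c x}"
      by (rule nn_integral_cmult_indicator) measurable
    also have "\<dots> = ennreal (1 / w (c x) * w (c x))"
      unfolding emeasure_eq_measure w_def by (subst ennreal_mult) auto
    also have "\<dots> = 1" using wx by simp
    finally show ?case unfolding w_def .
  qed
qed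

text \<open>A substitute for disintegration: on each cell of a partition into sets of diameter less than \<open>e\<close>,
  the two plans are conditioned on the cell and coupled independently.\<close>

lemma approximate_gluing:
  fixes \<mu> \<nu> \<sigma> :: "'a::{real_inner, second_countable_topology} measure"
  assumes \<gamma>\<^sub>1: "\<gamma>\<^sub>1 \<in> plans \<mu> \<nu>" and \<gamma>\<^sub>2: "\<gamma>\<^sub>2 \<in> plans \<nu> \<sigma>" and "0 < e"
  obtains \<pi> where "prob_space \<pi>" "fst \<in> measurable \<pi> \<gamma>\<^sub>1" "snd \<in> measurable \<pi> \<gamma>\<^sub>2"
    "distr \<pi> \<gamma>\<^sub>1 fst = \<gamma>\<^sub>1" "distr \<pi> \<gamma>\<^sub>2 snd = \<gamma>\<^sub>2"
    "AE p in \<pi>. norm (snd (fst p) - fst (snd p)) < e"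
proof -
  interpret \<gamma>1: prob_space \<gamma>\<^sub>1 by (rule plansD(2)[OF \<gamma>\<^sub>1])
  interpret \<gamma>2: prob_space \<gamma>\<^sub>2 by (rule plansD(2)[OF \<gamma>\<^sub>2])
  interpret pair_prob_space \<gamma>\<^sub>1 \<gamma>\<^sub>2 ..
  have [measurable]: "fst \<in> borel_measurable \<gamma>\<^sub>2" "snd \<in> borel_measurable \<gamma>\<^sub>1"
    by (simp_all add: measurable_cong_sets[OF plansD(1)[OF \<gamma>\<^sub>1] refl]
        measurable_cong_sets[OF plansD(1)[OF \<gamma>\<^sub>2] refl] borel_prod[symmetric])
  have \<nu>: "prob_space \<nu>" "sets \<nu> = sets borel"
    unfolding plansD(4)[OF \<gamma>\<^sub>1, symmetric] by (auto intro: \<gamma>1.prob_space_distr)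
  note \<nu>(2)[measurable_cong]
  \<comment> \<open>The cell of \<open>x\<close> is the first dense point within e/2, so two points
    of one cell are less than \<open>e\<close> apart.\<close>
  define c :: "'a \<Rightarrow> nat" where "c x = (LEAST i. dist x (dense_seq i) < e / 2)" for x
  have [measurable]: "c \<in> measurable borel (count_space UNIV)" unfolding c_def by measurable
  have c: "dist x (dense_seq (c x)) < e / 2" for x
  proof -
    obtain i where "dist x (dense_seq i) < e / 2" using dense_seqE[of "e / 2" x] \<open>0 < e\<close> by auto
    then show ?thesis unfolding c_def by (rule LeastI)
  qed
  have close: "norm (x - y) < e" if "c x = c y" for x y
    using c[of x] c[of y] that dist_triangle2[of x y "dense_seq (c x)"] by (simp add: dist_norm)
  define w where "w i = measure \<nu> {z \<in> space \<nu>. c z = i}" for i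
  define h where "h x y = (if c x = c y then ennreal (1 / w (c x)) else 0)" for x y
  \<comment> \<open>By symmetry the one identity \<open>h1\<close> yields both marginals: the
    density integrates to 1 in either variable.\<close>
  have h_sym: "h x y = h y x" for x y by (simp add: h_def)
  have "(\<lambda>(i, j). if i = j then ennreal (1 / w i) else 0) \<in> borel_measurable (count_space UNIV \<Otimes>\<^sub>M count_space UNIV)"
    by (simp add: pair_measure_countable)
  from measurable_compose[OF _ this, of "\<lambda>p. (c (fst p), c (snd p))" "borel \<Otimes>\<^sub>M borel"]
  have [measurable]: "case_prod h \<in> borel_measurable (borel \<Otimes>\<^sub>M borel)"
    by (simp add: h_def case_prod_unfold cong: if_cong)
  have h1: "AE x in \<nu>. (\<integral>\<^sup>+y. h x y \<partial>\<nu>) = 1"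
    unfolding h_def w_def by (rule same_cell_density[OF \<nu>(1)]) measurable
  have AE1: "AE z in \<gamma>\<^sub>1. (\<integral>\<^sup>+z'. h (snd z) (fst z') \<partial>\<gamma>\<^sub>2) = 1"
  proof -
    have "AE x in distr \<gamma>\<^sub>1 borel snd. (\<integral>\<^sup>+y. h x y \<partial>\<nu>) = 1"
      unfolding plansD(4)[OF \<gamma>\<^sub>1] by (rule h1)
    then have "AE z in \<gamma>\<^sub>1. (\<integral>\<^sup>+y. h (snd z) y \<partial>\<nu>) = 1"
      by (rule AE_distrD[rotated]) measurable
    moreover have "(\<integral>\<^sup>+y. h x y \<partial>\<nu>) = (\<integral>\<^sup>+z'. h x (fst z') \<partial>\<gamma>\<^sub>2)" for x
      by (subst plansD(3)[OF \<gamma>\<^sub>2, symmetric], rule nn_integral_distr) measurable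
    ultimately show ?thesis by simp
  qed
  have AE2: "AE z' in \<gamma>\<^sub>2. (\<integral>\<^sup>+z. h (snd z) (fst z') \<partial>\<gamma>\<^sub>1) = 1"
  proof -
    have "AE x in distr \<gamma>\<^sub>2 borel fst. (\<integral>\<^sup>+y. h x y \<partial>\<nu>) = 1"
      unfolding plansD(3)[OF \<gamma>\<^sub>2] by (rule h1)
    then have "AE z' in \<gamma>\<^sub>2. (\<integral>\<^sup>+y. h (fst z') y \<partial>\<nu>) = 1"
      by (rule AE_distrD[rotated]) measurable
    moreover have "(\<integral>\<^sup>+y. h x y \<partial>\<nu>) = (\<integral>\<^sup>+z. h (snd z) x \<partial>\<gamma>\<^sub>1)" for x
      unfolding h_sym[of _ x] by (subst plansD(4)[OF \<gamma>\<^sub>1, symmetric], rule nn_integral_distr) measurable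
    ultimately show ?thesis by simp
  qed
  define H where "H p = h (snd (fst p)) (fst (snd p))" for p :: "('a \<times> 'a) \<times> ('a \<times> 'a)"
  have H [measurable]: "H \<in> borel_measurable (\<gamma>\<^sub>1 \<Otimes>\<^sub>M \<gamma>\<^sub>2)"
    unfolding H_def by measurable
  define \<pi> where "\<pi> = density (\<gamma>\<^sub>1 \<Otimes>\<^sub>M \<gamma>\<^sub>2) H"
  have [measurable_cong]: "sets \<pi> = sets (\<gamma>\<^sub>1 \<Otimes>\<^sub>M \<gamma>\<^sub>2)" by (simp add: \<pi>_def)
  have m1: "fst \<in> measurable \<pi> \<gamma>\<^sub>1" and m2: "snd \<in> measurable \<pi> \<gamma>\<^sub>2" by measurable
  have fst: "distr \<pi> \<gamma>\<^sub>1 fst = \<gamma>\<^sub>1"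
  proof (rule measure_eqI)
    fix S assume "S \<in> sets (distr \<pi> \<gamma>\<^sub>1 fst)"
    then have [measurable]: "S \<in> sets \<gamma>\<^sub>1" by simp
    have "emeasure (distr \<pi> \<gamma>\<^sub>1 fst) S = (\<integral>\<^sup>+p. indicator S (fst p) \<partial>\<pi>)"
      using m1 by (simp add: nn_integral_distr flip: nn_integral_indicator)
    also have "\<dots> = (\<integral>\<^sup>+p. H p * indicator S (fst p) \<partial>(\<gamma>\<^sub>1 \<Otimes>\<^sub>M \<gamma>\<^sub>2))"
      unfolding \<pi>_def by (rule nn_integral_density) measurable
    also have "\<dots> = (\<integral>\<^sup>+z. \<integral>\<^sup>+z'. H (z, z') * indicator S z \<partial>\<gamma>\<^sub>2 \<partial>\<gamma>\<^sub>1)"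
      using \<gamma>2.nn_integral_fst[of "\<lambda>p. H p * indicator S (fst p)"] by simp
    also have "\<dots> = (\<integral>\<^sup>+z. indicator S z \<partial>\<gamma>\<^sub>1)"
    proof (rule nn_integral_cong_AE)
      show "AE z in \<gamma>\<^sub>1. (\<integral>\<^sup>+z'. H (z, z') * indicator S z \<partial>\<gamma>\<^sub>2) = indicator S z"
        using AE1 AE_space
      proof eventually_elim
        case (elim z)
        have "(\<integral>\<^sup>+z'. H (z, z') * indicator S z \<partial>\<gamma>\<^sub>2) = (\<integral>\<^sup>+z'. H (z, z') \<partial>\<gamma>\<^sub>2) * indicator S z"
          using elim(2) by (intro nn_integral_multc) measurable
        then show ?case using elim(1) by (simp add: H_def)
      qed
    qed
    also have "\<dots> = emeasure \<gamma>\<^sub>1 S" by simp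
    finally show "emeasure (distr \<pi> \<gamma>\<^sub>1 fst) S = emeasure \<gamma>\<^sub>1 S" .
  qed simp
  have snd: "distr \<pi> \<gamma>\<^sub>2 snd = \<gamma>\<^sub>2"
  proof (rule measure_eqI)
    fix S assume "S \<in> sets (distr \<pi> \<gamma>\<^sub>2 snd)"
    then have [measurable]: "S \<in> sets \<gamma>\<^sub>2" by simp
    have "emeasure (distr \<pi> \<gamma>\<^sub>2 snd) S = (\<integral>\<^sup>+p. indicator S (snd p) \<partial>\<pi>)"
      using m2 by (simp add: nn_integral_distr flip: nn_integral_indicator)
    also have "\<dots> = (\<integral>\<^sup>+p. H p * indicator S (snd p) \<partial>(\<gamma>\<^sub>1 \<Otimes>\<^sub>M \<gamma>\<^sub>2))"
      unfolding \<pi>_def by (rule nn_integral_density) measurable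
    also have "\<dots> = (\<integral>\<^sup>+z'. \<integral>\<^sup>+z. H (z, z') * indicator S z' \<partial>\<gamma>\<^sub>1 \<partial>\<gamma>\<^sub>2)"
      using nn_integral_snd[of "\<lambda>p. H p * indicator S (snd p)"] by simp
    also have "\<dots> = (\<integral>\<^sup>+z'. indicator S z' \<partial>\<gamma>\<^sub>2)"
    proof (rule nn_integral_cong_AE)
      show "AE z' in \<gamma>\<^sub>2. (\<integral>\<^sup>+z. H (z, z') * indicator S z' \<partial>\<gamma>\<^sub>1) = indicator S z'"
        using AE2 AE_space
      proof eventually_elim
        case (elim z')
        have "(\<integral>\<^sup>+z. H (z, z') * indicator S z' \<partial>\<gamma>\<^sub>1) = (\<integral>\<^sup>+z. H (z, z') \<partial>\<gamma>\<^sub>1) * indicator S z'"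
          using elim(2) by (intro nn_integral_multc) measurable
        then show ?case using elim(1) by (simp add: H_def)
      qed
    qed
    also have "\<dots> = emeasure \<gamma>\<^sub>2 S" by simp
    finally show "emeasure (distr \<pi> \<gamma>\<^sub>2 snd) S = emeasure \<gamma>\<^sub>2 S" .
  qed simp
  have "prob_space (distr \<pi> \<gamma>\<^sub>1 fst)" unfolding fst by (rule plansD(2)[OF \<gamma>\<^sub>1])
  then have "prob_space \<pi>" by (rule prob_space_distrD[OF m1])
  moreover have "AE p in \<pi>. norm (snd (fst p) - fst (snd p)) < e"
    unfolding \<pi>_def AE_density[OF H] by (intro AE_I2) (auto simp: H_def h_def close split: if_splits)
  ultimately show thesis using m1 m2 fst snd by (intro that)
qed

text \<open>This replaces Minkowski's inequality. Applied pointwise with weights that bound the two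
  L2 norms and then integrated, it gives at most (A + B)^2, without loss.\<close>

lemma weighted_square_sum_le:
  fixes p q A B :: real
  assumes "0 < A" "0 < B"
  shows "(p + q)\<^sup>2 \<le> (A + B) * (p\<^sup>2 / A + q\<^sup>2 / B)"
proof -
  have "(A + B) * (p\<^sup>2 / A + q\<^sup>2 / B) - (p + q)\<^sup>2 = (p * B - q * A)\<^sup>2 / (A * B)"
    using assms by (simp add: field_simps power2_eq_square)
  moreover have "0 \<le> (p * B - q * A)\<^sup>2 / (A * B)" using assms by simp
  ultimately show ?thesis by linarith
qed

lemma W2_triangle:
  fixes \<mu> \<nu> \<sigma> :: "'a::{real_inner, second_countable_topology} measure"
  assumes P2: "\<mu> \<in> P2" "\<nu> \<in> P2" "\<sigma> \<in> P2"
  shows "W2 \<mu> \<sigma> \<le> W2 \<mu> \<nu> + W2 \<nu> \<sigma>"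
proof (rule field_le_epsilon)
  fix e :: real assume "0 < e"
  \<comment> \<open>Each of the three terms absorbs a third of the error. \<open>A\<close> and
    \<open>B\<close> are the weights of the two near-optimal plans and stay positive even if a
    distance is 0; \<open>E\<close> pays for the mismatch of the middle points in the glued
    plan.\<close>
  define A where "A = W2 \<mu> \<nu> + e / 3"
  define B where "B = W2 \<nu> \<sigma> + e / 3"
  define E where "E = e / 3"
  have pos: "0 < A" "0 < B" "0 < E" using \<open>0 < e\<close> by (auto simp: A_def B_def E_def add_nonneg_pos)
  have "(W2 \<mu> \<nu>)\<^sup>2 < A\<^sup>2" using \<open>0 < e\<close> by (intro power_strict_mono) (auto simp: A_def)
  then obtain \<gamma>\<^sub>1 where \<gamma>\<^sub>1: "\<gamma>\<^sub>1 \<in> plans \<mu> \<nu>" "(\<integral>z. (norm (fst z - snd z))\<^sup>2 \<partial>\<gamma>\<^sub>1) < A\<^sup>2"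
    by (rule near_optimal_plan[OF P2(1,2)])
  have "(W2 \<nu> \<sigma>)\<^sup>2 < B\<^sup>2" using \<open>0 < e\<close> by (intro power_strict_mono) (auto simp: B_def)
  then obtain \<gamma>\<^sub>2 where \<gamma>\<^sub>2: "\<gamma>\<^sub>2 \<in> plans \<nu> \<sigma>" "(\<integral>z. (norm (fst z - snd z))\<^sup>2 \<partial>\<gamma>\<^sub>2) < B\<^sup>2"
    by (rule near_optimal_plan[OF P2(2,3)])
  obtain \<pi> where \<pi>: "prob_space \<pi>" and meas [measurable]: "fst \<in> measurable \<pi> \<gamma>\<^sub>1" "snd \<in> measurable \<pi> \<gamma>\<^sub>2"
    and d: "distr \<pi> \<gamma>\<^sub>1 fst = \<gamma>\<^sub>1" "distr \<pi> \<gamma>\<^sub>2 snd = \<gamma>\<^sub>2"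
    and close: "AE p in \<pi>. norm (snd (fst p) - fst (snd p)) < E"
    using approximate_gluing[OF \<gamma>\<^sub>1(1) \<gamma>\<^sub>2(1) pos(3)] by blast
  interpret prob_space \<pi> by (rule \<pi>)
  note p1 = plans_integrable[OF \<gamma>\<^sub>1(1) P2(1,2)] and p2 = plans_integrable[OF \<gamma>\<^sub>2(1) P2(2,3)]
  note [measurable] = p1(1,2) p2(1,2)
  define f where "f p = (norm (fst (fst p) - snd (fst p)))\<^sup>2" for p :: "('a \<times> 'a) \<times> ('a \<times> 'a)"
  define g where "g p = (norm (fst (snd p) - snd (snd p)))\<^sup>2" for p :: "('a \<times> 'a) \<times> ('a \<times> 'a)"
  have "integrable (distr \<pi> \<gamma>\<^sub>1 fst) (\<lambda>z. (norm (fst z - snd z))\<^sup>2)" "(\<integral>z. (norm (fst z - snd z))\<^sup>2 \<partial>distr \<pi> \<gamma>\<^sub>1 fst) < A\<^sup>2"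
    unfolding d by (fact p1(5), fact \<gamma>\<^sub>1(2))
  then have f: "integrable \<pi> f" "(\<integral>p. f p \<partial>\<pi>) < A\<^sup>2"
    by (simp_all add: f_def[abs_def] integrable_distr_eq integral_distr)
  have "integrable (distr \<pi> \<gamma>\<^sub>2 snd) (\<lambda>z. (norm (fst z - snd z))\<^sup>2)" "(\<integral>z. (norm (fst z - snd z))\<^sup>2 \<partial>distr \<pi> \<gamma>\<^sub>2 snd) < B\<^sup>2"
    unfolding d by (fact p2(5), fact \<gamma>\<^sub>2(2))
  then have g: "integrable \<pi> g" "(\<integral>p. g p \<partial>\<pi>) < B\<^sup>2"
    by (simp_all add: g_def[abs_def] integrable_distr_eq integral_distr)
  have "integrable (distr \<pi> \<gamma>\<^sub>1 fst) (\<lambda>z. (norm (fst z))\<^sup>2)" unfolding d by (fact p1(3))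
  then have U: "integrable \<pi> (\<lambda>p. (norm (fst (fst p)))\<^sup>2)" by (simp add: integrable_distr_eq)
  have "integrable (distr \<pi> \<gamma>\<^sub>2 snd) (\<lambda>z. (norm (snd z))\<^sup>2)" unfolding d by (fact p2(4))
  then have V: "integrable \<pi> (\<lambda>p. (norm (snd (snd p)))\<^sup>2)" by (simp add: integrable_distr_eq)
  have UV [measurable]: "(\<lambda>p. fst (fst p)) \<in> borel_measurable \<pi>" "(\<lambda>p. snd (snd p)) \<in> borel_measurable \<pi>"
    by measurable
  have \<mu>: "distr \<pi> borel (\<lambda>p. fst (fst p)) = \<mu>"
    using distr_distr[OF p1(1) meas(1)] plansD(3)[OF \<gamma>\<^sub>1(1)] by (simp add: d comp_def)
  have \<sigma>: "distr \<pi> borel (\<lambda>p. snd (snd p)) = \<sigma>"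
    using distr_distr[OF p2(2) meas(2)] plansD(4)[OF \<gamma>\<^sub>2(1)] by (simp add: d comp_def)
  have "(W2 \<mu> \<sigma>)\<^sup>2 \<le> (\<integral>p. (norm (fst (fst p) - snd (snd p)))\<^sup>2 \<partial>\<pi>)"
    using W2_le_coupling[OF \<pi> UV U V] by (simp add: \<mu> \<sigma>)
  also have "\<dots> \<le> (\<integral>p. (A + B + E) * (f p / A + g p / B + E) \<partial>\<pi>)"
  proof (rule integral_mono_AE)
    show "integrable \<pi> (\<lambda>p. (norm (fst (fst p) - snd (snd p)))\<^sup>2)"
      by (rule integrable_norm_diff_sq[OF UV U V])
    show "integrable \<pi> (\<lambda>p. (A + B + E) * (f p / A + g p / B + E))" using f(1) g(1) by simp
    show "AE p in \<pi>. (norm (fst (fst p) - snd (snd p)))\<^sup>2 \<le> (A + B + E) * (f p / A + g p / B + E)"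
      using close
    proof eventually_elim
      case (elim p)
      define a b c where "a = norm (fst (fst p) - snd (fst p))" and "b = norm (fst (snd p) - snd (snd p))"
        and "c = norm (snd (fst p) - fst (snd p))"
      have "norm (fst (fst p) - snd (snd p)) \<le> norm (fst (fst p) - snd (fst p)) + norm (snd (fst p) - fst (snd p)) + norm (fst (snd p) - snd (snd p))"
        using dist_triangle[of "fst (fst p)" "snd (snd p)" "snd (fst p)"] dist_triangle[of "snd (fst p)" "snd (snd p)" "fst (snd p)"]
        unfolding dist_norm by linarith
      then have "(norm (fst (fst p) - snd (snd p)))\<^sup>2 \<le> ((a + b) + c)\<^sup>2"
        unfolding a_def b_def c_def by (intro power_mono) auto
      also have "\<dots> \<le> (A + B + E) * ((a + b)\<^sup>2 / (A + B) + c\<^sup>2 / E)"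
        by (rule weighted_square_sum_le) (use pos in auto)
      also have "\<dots> \<le> (A + B + E) * ((a\<^sup>2 / A + b\<^sup>2 / B) + E)"
      proof (intro mult_left_mono add_mono)
        show "(a + b)\<^sup>2 / (A + B) \<le> a\<^sup>2 / A + b\<^sup>2 / B"
          using weighted_square_sum_le[OF pos(1,2), of a b] pos by (simp add: pos_divide_le_eq mult.commute)
        have "c\<^sup>2 \<le> E\<^sup>2" using elim by (intro power_mono) (auto simp: c_def)
        then show "c\<^sup>2 / E \<le> E" using pos by (simp add: pos_divide_le_eq power2_eq_square)
      qed (use pos in auto)
      finally show ?case by (simp add: f_def g_def a_def b_def)
    qed
  qed
  also have "\<dots> = (A + B + E) * ((\<integral>p. f p \<partial>\<pi>) / A + (\<integral>p. g p \<partial>\<pi>) / B + E)"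
    using f(1) g(1) by (simp add: prob_space)
  also have "\<dots> \<le> (A + B + E) * (A + B + E)"
    using f(2) g(2) pos by (intro mult_left_mono add_mono) (auto simp: pos_divide_le_eq power2_eq_square)
  finally have "(W2 \<mu> \<sigma>)\<^sup>2 \<le> (A + B + E)\<^sup>2" by (simp add: power2_eq_square)
  then have "W2 \<mu> \<sigma> \<le> A + B + E" by (rule power2_le_imp_le) (use pos in auto)
  then show "W2 \<mu> \<sigma> \<le> W2 \<mu> \<nu> + W2 \<nu> \<sigma> + e" by (simp add: A_def B_def E_def)
qed

section \<open>Opial's property\<close>

lemma inner_Pair_zero:
  fixes z :: "'a::real_inner \<times> 'b::real_inner"
  shows "z \<bullet> (y, 0) = fst z \<bullet> y" "z \<bullet> (0, y') = snd z \<bullet> y'"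
  by (simp_all add: inner_prod_def)

lemma weakly_converges_fst:
  assumes "weakly_converges z l"
  shows "weakly_converges (\<lambda>k. fst (z k)) (fst l)"
  unfolding weakly_converges_def
proof
  show "(\<lambda>k. fst (z k) \<bullet> y) \<longlonglongrightarrow> fst l \<bullet> y" for y
    using assms[unfolded weakly_converges_def, rule_format, of "(y, 0)"] by (simp only: inner_Pair_zero)
qed

lemma weakly_converges_snd:
  assumes "weakly_converges z l"
  shows "weakly_converges (\<lambda>k. snd (z k)) (snd l)"
  unfolding weakly_converges_def
proof
  show "(\<lambda>k. snd (z k) \<bullet> y) \<longlonglongrightarrow> snd l \<bullet> y" for y
    using assms[unfolded weakly_converges_def, rule_format, of "(0, y)"] by (simp only: inner_Pair_zero)
qed

lemma norm_prod_sq: "(norm z)\<^sup>2 = (norm (fst z))\<^sup>2 + (norm (snd z))\<^sup>2"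
  by (simp add: norm_prod_def)

lemma (in weakly_convergent_L2) P2w_limit_unique:
  assumes "\<mu> \<in> P2" and "\<And>\<zeta>. \<zeta> \<in> P2w_test \<Longrightarrow> (\<lambda>k. \<integral>w. \<zeta> (X k w) \<partial>M) \<longlonglongrightarrow> (\<integral>x. \<zeta> x \<partial>\<mu>)"
  shows "distr M borel Y = \<mu>"
proof (rule measure_eqI_P2w_test)
  fix \<zeta> :: "'a \<Rightarrow> real" assume \<zeta>: "\<zeta> \<in> P2w_test"
  note P2w_test_borel[OF \<zeta>, measurable]
  have "(\<integral>x. \<zeta> x \<partial>distr M borel Y) = (\<integral>w. \<zeta> (Y w) \<partial>M)" by (rule integral_distr) measurable
  also have "\<dots> = (\<integral>x. \<zeta> x \<partial>\<mu>)"
    using integral_test_tendsto[OF \<zeta>] assms(2)[OF \<zeta>] by (rule LIMSEQ_unique)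
  finally show "(\<integral>x. \<zeta> x \<partial>distr M borel Y) = (\<integral>x. \<zeta> x \<partial>\<mu>)" .
qed (use P2D[OF assms(1)] Y in \<open>auto intro: prob_space_distr\<close>)

text \<open>Represent nearly optimal plans between \<open>\<nu>\<close> and \<open>\<mu>\<^sub>k\<close> by random variables \<open>(Y\<^sub>k, X\<^sub>k)\<close> that converge weakly
  almost surely to \<open>(Y, X)\<close>. Every \<open>Y\<^sub>k\<close> has law \<open>\<nu>\<close>, so \<open>Y\<^sub>k \<rightarrow> Y\<close> even in \<open>L\<^sup>2\<close>, and expanding the squares gives
  \<open>E |Y\<^sub>k - X\<^sub>k|\<^sup>2 - E |X - X\<^sub>k|\<^sup>2 \<rightarrow> E |Y - X|\<^sup>2 > 0\<close>.\<close>

lemma opial: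
  fixes \<mu> :: "nat \<Rightarrow> 'a::{real_inner, complete_space, second_countable_topology} measure"
  assumes \<mu>: "\<And>k. \<mu> k \<in> P2" and bound: "\<And>k. (\<integral>x. (norm x)\<^sup>2 \<partial>\<mu> k) \<le> C"
    and \<mu>': "\<mu>' \<in> P2" and \<nu>: "\<nu> \<in> P2" and "\<nu> \<noteq> \<mu>'"
    and lim: "\<And>\<zeta>. \<zeta> \<in> P2w_test \<Longrightarrow> (\<lambda>k. \<integral>x. \<zeta> x \<partial>\<mu> k) \<longlonglongrightarrow> (\<integral>x. \<zeta> x \<partial>\<mu>')"
  obtains r \<delta> where "strict_mono (r :: nat \<Rightarrow> nat)" "0 < \<delta>"
    "\<forall>\<^sub>F k in sequentially. (W2 \<mu>' (\<mu> (r k)))\<^sup>2 + \<delta> \<le> (W2 \<nu> (\<mu> (r k)))\<^sup>2"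
proof -
  define N where "N = (\<integral>x. (norm x)\<^sup>2 \<partial>\<nu>)"
  have "\<exists>\<gamma>. \<gamma> \<in> plans \<nu> (\<mu> k) \<and> (\<integral>z. (norm (fst z - snd z))\<^sup>2 \<partial>\<gamma>) < (W2 \<nu> (\<mu> k))\<^sup>2 + 1 / real (Suc k)" for k
  proof -
    have "(W2 \<nu> (\<mu> k))\<^sup>2 < (W2 \<nu> (\<mu> k))\<^sup>2 + 1 / real (Suc k)" by simp
    then obtain \<gamma> where "\<gamma> \<in> plans \<nu> (\<mu> k)"
        "(\<integral>z. (norm (fst z - snd z))\<^sup>2 \<partial>\<gamma>) < (W2 \<nu> (\<mu> k))\<^sup>2 + 1 / real (Suc k)"
      by (rule near_optimal_plan[OF \<nu> \<mu>])
    then show ?thesis by (intro exI conjI)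
  qed
  then have "\<exists>\<gamma>. \<forall>k. \<gamma> k \<in> plans \<nu> (\<mu> k) \<and>
      (\<integral>z. (norm (fst z - snd z))\<^sup>2 \<partial>\<gamma> k) < (W2 \<nu> (\<mu> k))\<^sup>2 + 1 / real (Suc k)"
    by (intro choice allI)
  then obtain \<gamma> where \<gamma>: "\<And>k. \<gamma> k \<in> plans \<nu> (\<mu> k)"
    and opt: "\<And>k. (\<integral>z. (norm (fst z - snd z))\<^sup>2 \<partial>\<gamma> k) < (W2 \<nu> (\<mu> k))\<^sup>2 + 1 / real (Suc k)"
    by blast
  note pi = plans_integrable[OF \<gamma> \<nu> \<mu>]
  \<comment> \<open>The plans are themselves measures with bounded second moments on the Hilbert
    space of pairs. Representing them, rather than their marginals, keeps each coupling on the
    common probability space.\<close>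
  have "\<gamma> k \<in> P2" for k
    using plansD(1,2)[OF \<gamma>] pi(3,4) by (auto simp: P2_def norm_prod_sq)
  moreover have "(\<integral>z. (norm z)\<^sup>2 \<partial>\<gamma> k) \<le> N + C" for k
    unfolding norm_prod_sq using pi(3,4,6,7)[of k] bound[of k] by (simp add: N_def)
  ultimately obtain r and \<Omega> :: "real measure" and Z Z' where r: "strict_mono (r :: nat \<Rightarrow> nat)"
    "weakly_convergent_L2 \<Omega> Z Z' (N + C)" and dZ: "\<And>k. distr \<Omega> borel (Z k) = \<gamma> (r k)"
    using weak_skorokhod_L2[of \<gamma> "N + C"] by blast
  interpret Z: weakly_convergent_L2 \<Omega> Z Z' "N + C" by (rule r(2))
  have [measurable]: "fst \<in> borel_measurable (borel :: ('a \<times> 'a) measure)"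
    "snd \<in> borel_measurable (borel :: ('a \<times> 'a) measure)" by (simp_all add: borel_prod[symmetric])
  define Y where "Y k w = fst (Z k w)" for k w
  define X where "X k w = snd (Z k w)" for k w
  define Y' where "Y' w = fst (Z' w)" for w
  define X' where "X' w = snd (Z' w)" for w
  have [measurable]: "Y k \<in> borel_measurable \<Omega>" "X k \<in> borel_measurable \<Omega>"
    "Y' \<in> borel_measurable \<Omega>" "X' \<in> borel_measurable \<Omega>" for k
    unfolding Y_def X_def Y'_def X'_def by measurable
  have dY: "distr \<Omega> borel (Y k) = \<nu>" for k
    unfolding plansD(3)[OF \<gamma>[of "r k"], symmetric] dZ[symmetric]
    by (subst distr_distr) (auto simp: comp_def Y_def[abs_def])
  have dX: "distr \<Omega> borel (X k) = \<mu> (r k)" for k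
    unfolding plansD(4)[OF \<gamma>[of "r k"], symmetric] dZ[symmetric]
    by (subst distr_distr) (auto simp: comp_def X_def[abs_def])
  have second: "integrable \<Omega> (\<lambda>w. (norm (U w))\<^sup>2)" "(\<integral>w. (norm (U w))\<^sup>2 \<partial>\<Omega>) = (\<integral>x. (norm x)\<^sup>2 \<partial>\<rho>)"
    if [measurable]: "U \<in> borel_measurable \<Omega>" and d: "distr \<Omega> borel U = \<rho>" and \<rho>: "\<rho> \<in> P2" for U :: "real \<Rightarrow> 'a" and \<rho>
    using P2D(3)[OF \<rho>] unfolding d[symmetric] by (simp_all add: integrable_distr_eq integral_distr)
  have Y2: "integrable \<Omega> (\<lambda>w. (norm (Y k w))\<^sup>2)" "(\<integral>w. (norm (Y k w))\<^sup>2 \<partial>\<Omega>) = N" for k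
    using second[OF _ dY \<nu>] by (simp_all add: N_def)
  have X2: "integrable \<Omega> (\<lambda>w. (norm (X k w))\<^sup>2)" "(\<integral>w. (norm (X k w))\<^sup>2 \<partial>\<Omega>) \<le> C" for k
    using second[OF _ dX \<mu>] bound by simp_all
  interpret Y: weakly_convergent_L2 \<Omega> Y Y' N
    by unfold_locales (use Y2 Z.weakly in \<open>auto simp: Y_def Y'_def intro: weakly_converges_fst elim: eventually_mono\<close>)
  interpret X: weakly_convergent_L2 \<Omega> X X' C
    by unfold_locales (use X2 Z.weakly in \<open>auto simp: X_def X'_def intro: weakly_converges_snd elim: eventually_mono\<close>)
  have dY': "distr \<Omega> borel Y' = \<nu>"
  proof (rule Y.P2w_limit_unique[OF \<nu>])
    fix \<zeta> :: "'a \<Rightarrow> real" assume "\<zeta> \<in> P2w_test"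
    note P2w_test_borel[OF this, measurable]
    have "(\<integral>w. \<zeta> (Y k w) \<partial>\<Omega>) = (\<integral>x. \<zeta> x \<partial>\<nu>)" for k
      unfolding dY[of k, symmetric] by (rule integral_distr[symmetric]) measurable
    then show "(\<lambda>k. \<integral>w. \<zeta> (Y k w) \<partial>\<Omega>) \<longlonglongrightarrow> (\<integral>x. \<zeta> x \<partial>\<nu>)" by simp
  qed
  have dX': "distr \<Omega> borel X' = \<mu>'"
  proof (rule X.P2w_limit_unique[OF \<mu>'])
    fix \<zeta> :: "'a \<Rightarrow> real" assume \<zeta>: "\<zeta> \<in> P2w_test"
    note P2w_test_borel[OF this, measurable]
    have "(\<integral>w. \<zeta> (X k w) \<partial>\<Omega>) = (\<integral>x. \<zeta> x \<partial>\<mu> (r k))" for k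
      unfolding dX[of k, symmetric] by (rule integral_distr[symmetric]) measurable
    then show "(\<lambda>k. \<integral>w. \<zeta> (X k w) \<partial>\<Omega>) \<longlonglongrightarrow> (\<integral>x. \<zeta> x \<partial>\<mu>')"
      using LIMSEQ_subseq_LIMSEQ[OF lim[OF \<zeta>] r(1)] by (simp add: comp_def)
  qed
  have Y'2: "integrable \<Omega> (\<lambda>w. (norm (Y' w))\<^sup>2)" "(\<integral>w. (norm (Y' w))\<^sup>2 \<partial>\<Omega>) = N"
    using second[OF _ dY' \<nu>] by (simp_all add: N_def)
  have X'2: "integrable \<Omega> (\<lambda>w. (norm (X' w))\<^sup>2)"
    using second[OF _ dX' \<mu>'] by simp
  have inner: "integrable \<Omega> (\<lambda>w. U w \<bullet> V w)"
    "(\<integral>w. (norm (U w - V w))\<^sup>2 \<partial>\<Omega>) = (\<integral>w. (norm (U w))\<^sup>2 \<partial>\<Omega>) - 2 * (\<integral>w. U w \<bullet> V w \<partial>\<Omega>) + (\<integral>w. (norm (V w))\<^sup>2 \<partial>\<Omega>)"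
    if UV: "U \<in> borel_measurable \<Omega>" "V \<in> borel_measurable \<Omega>"
      "integrable \<Omega> (\<lambda>w. (norm (U w))\<^sup>2)" "integrable \<Omega> (\<lambda>w. (norm (V w))\<^sup>2)" for U V :: "real \<Rightarrow> 'a"
  proof -
    show i: "integrable \<Omega> (\<lambda>w. U w \<bullet> V w)" by (rule X.inner_int[OF UV])
    have "(norm (U w - V w))\<^sup>2 = (norm (U w))\<^sup>2 - 2 * (U w \<bullet> V w) + (norm (V w))\<^sup>2" for w
      by (simp add: power2_norm_eq_inner inner_simps inner_commute)
    then show "(\<integral>w. (norm (U w - V w))\<^sup>2 \<partial>\<Omega>) = (\<integral>w. (norm (U w))\<^sup>2 \<partial>\<Omega>) - 2 * (\<integral>w. U w \<bullet> V w \<partial>\<Omega>) + (\<integral>w. (norm (V w))\<^sup>2 \<partial>\<Omega>)"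
      using i UV(3,4) by simp
  qed
  note Ym = Y.X Y.Y X.X X.Y
  \<comment> \<open>Weak convergence with convergent norms is strong: all second moments equal
    \<open>N\<close>, so the expanded square tends to N - 2 N + N.\<close>
  define s where "s k = (\<integral>w. (norm (Y k w - Y' w))\<^sup>2 \<partial>\<Omega>)" for k
  have "s \<longlonglongrightarrow> N - 2 * (\<integral>w. Y' w \<bullet> Y' w \<partial>\<Omega>) + N"
    unfolding s_def inner(2)[OF Y.X Y.Y Y2(1) Y'2(1)] Y2(2) Y'2(2)
    by (intro tendsto_add tendsto_diff tendsto_mult tendsto_const Y.integral_inner_tendsto Y.Y Y'2(1))
  also have "N - 2 * (\<integral>w. Y' w \<bullet> Y' w \<partial>\<Omega>) + N = 0"
    using Y'2(2) by (simp add: power2_norm_eq_inner)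
  finally have s: "s \<longlonglongrightarrow> 0" .
  \<comment> \<open>Both factors move here, and weak convergence of both would not suffice. Strong
    convergence of \<open>Y k\<close> against the bounded \<open>X k\<close> makes \<open>u\<close>
    vanish.\<close>
  define u where "u k = (\<integral>w. (Y k w - Y' w) \<bullet> X k w \<partial>\<Omega>)" for k
  have u_le: "\<bar>u k\<bar> \<le> s k / (4 * e) + e * C" if "0 < e" for e k
  proof -
    have dom: "integrable \<Omega> (\<lambda>w. (norm (Y k w - Y' w))\<^sup>2 / (4 * e) + e * (norm (X k w))\<^sup>2)"
      using Y.diff_bound(1)[of k] X2(1)[of k] by simp
    have le: "\<bar>(Y k w - Y' w) \<bullet> X k w\<bar> \<le> (norm (Y k w - Y' w))\<^sup>2 / (4 * e) + e * (norm (X k w))\<^sup>2" for w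
    proof -
      have "\<bar>(Y k w - Y' w) \<bullet> X k w\<bar> \<le> norm (Y k w - Y' w) * norm (X k w)" by (rule Cauchy_Schwarz_ineq2)
      also have "\<dots> \<le> (norm (Y k w - Y' w))\<^sup>2 / (4 * e) + e * (norm (X k w))\<^sup>2"
      proof -
        have "0 \<le> (2 * e * norm (X k w) - norm (Y k w - Y' w))\<^sup>2" by simp
        then show ?thesis using that by (simp add: field_simps power2_eq_square)
      qed
      finally show ?thesis .
    qed
    have "integrable \<Omega> (\<lambda>w. \<bar>(Y k w - Y' w) \<bullet> X k w\<bar>)"
      by (intro integrable_abs X.inner_int borel_measurable_diff Ym Y.diff_bound X2(1))
    then have "(\<integral>w. \<bar>(Y k w - Y' w) \<bullet> X k w\<bar> \<partial>\<Omega>) \<le> (\<integral>w. (norm (Y k w - Y' w))\<^sup>2 / (4 * e) + e * (norm (X k w))\<^sup>2 \<partial>\<Omega>)"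
      by (rule integral_mono[OF _ dom le])
    also have "\<dots> = s k / (4 * e) + e * (\<integral>w. (norm (X k w))\<^sup>2 \<partial>\<Omega>)"
      unfolding s_def using Y.diff_bound(1)[of k] X2(1)[of k] by simp
    also have "\<dots> \<le> s k / (4 * e) + e * C" using X2(2)[of k] that by simp
    finally show ?thesis unfolding u_def by (rule order_trans[OF integral_abs_bound])
  qed
  have u: "u \<longlonglongrightarrow> 0"
  proof (rule LIMSEQ_I)
    fix \<epsilon> :: real assume "0 < \<epsilon>"
    define e where "e = \<epsilon> / (2 * (C + 1))"
    have e: "0 < e" "e * C < \<epsilon> / 2" using \<open>0 < \<epsilon>\<close> X.C_nonneg by (simp_all add: e_def field_simps)
    have "(\<lambda>k. s k / (4 * e)) \<longlonglongrightarrow> 0 / (4 * e)" using e(1) by (intro tendsto_divide s tendsto_const) simp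
    then have "(\<lambda>k. s k / (4 * e)) \<longlonglongrightarrow> 0" by simp
    moreover have "0 < \<epsilon> / 2" using \<open>0 < \<epsilon>\<close> by simp
    ultimately have "\<exists>K. \<forall>k\<ge>K. norm (s k / (4 * e) - 0) < \<epsilon> / 2" by (rule LIMSEQ_D)
    then obtain K where K: "\<And>k. k \<ge> K \<Longrightarrow> \<bar>s k / (4 * e)\<bar> < \<epsilon> / 2" by auto
    have "norm (u k - 0) < \<epsilon>" if "k \<ge> K" for k
      using u_le[OF e(1), of k] K[OF that] e(2) unfolding real_norm_def diff_0_right by linarith
    then show "\<exists>K. \<forall>k\<ge>K. norm (u k - 0) < \<epsilon>" by blast
  qed
  define a where "a k = (\<integral>w. (norm (Y k w - X k w))\<^sup>2 \<partial>\<Omega>)" for k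
  define b where "b k = (\<integral>w. (norm (X' w - X k w))\<^sup>2 \<partial>\<Omega>)" for k
  define D where "D = (\<integral>w. (norm (Y' w - X' w))\<^sup>2 \<partial>\<Omega>)"
  \<comment> \<open>The second moment of \<open>X k\<close>, whose limit is unknown, has cancelled.
    Apart from \<open>u k\<close> only inner products with the fixed \<open>Y'\<close> and
    \<open>X'\<close> depend on \<open>k\<close>.\<close>
  have ab: "a k - b k = N - 2 * (u k + (\<integral>w. X k w \<bullet> Y' w \<partial>\<Omega>)) - (\<integral>w. (norm (X' w))\<^sup>2 \<partial>\<Omega>) + 2 * (\<integral>w. X k w \<bullet> X' w \<partial>\<Omega>)" for k
  proof -
    have "u k = (\<integral>w. Y k w \<bullet> X k w \<partial>\<Omega>) - (\<integral>w. X k w \<bullet> Y' w \<partial>\<Omega>)"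
      unfolding u_def inner_diff_left using inner(1)[OF Y.X X.X Y2(1) X2(1), of k k] inner(1)[OF Y.Y X.X Y'2(1) X2(1), of k]
      by (simp add: inner_commute)
    then show ?thesis
      unfolding a_def b_def inner(2)[OF Y.X X.X Y2(1) X2(1)] inner(2)[OF X.Y X.X X'2(1) X2(1)] Y2(2)
      by (simp add: inner_commute)
  qed
  have "(\<lambda>k. a k - b k) \<longlonglongrightarrow> N - 2 * (0 + (\<integral>w. X' w \<bullet> Y' w \<partial>\<Omega>)) - (\<integral>w. (norm (X' w))\<^sup>2 \<partial>\<Omega>) + 2 * (\<integral>w. X' w \<bullet> X' w \<partial>\<Omega>)"
    unfolding ab
    by (intro tendsto_add tendsto_diff tendsto_mult tendsto_const u X.integral_inner_tendsto Y.Y X.Y Y'2(1) X'2(1))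
  also have "N - 2 * (0 + (\<integral>w. X' w \<bullet> Y' w \<partial>\<Omega>)) - (\<integral>w. (norm (X' w))\<^sup>2 \<partial>\<Omega>) + 2 * (\<integral>w. X' w \<bullet> X' w \<partial>\<Omega>) = D"
    unfolding D_def inner(2)[OF Y.Y X.Y Y'2(1) X'2(1)] Y'2(2)
    by (simp add: power2_norm_eq_inner inner_commute)
  finally have lim_ab: "(\<lambda>k. a k - b k) \<longlonglongrightarrow> D" .
  have "0 < D"
  proof (rule ccontr)
    assume "\<not> 0 < D"
    then have "D = 0" unfolding D_def by (smt (verit) Bochner_Integration.integral_nonneg zero_le_power2)
    then have "AE w in \<Omega>. (norm (Y' w - X' w))\<^sup>2 = 0"
      unfolding D_def using integrable_norm_diff_sq[OF Y.Y X.Y Y'2(1) X'2(1)]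
      by (subst (asm) integral_nonneg_eq_0_iff_AE) auto
    then have "AE w in \<Omega>. Y' w = X' w" by (rule eventually_mono) simp
    then have "distr \<Omega> borel Y' = distr \<Omega> borel X'"
      by (intro distr_cong_AE) auto
    then show False using dY' dX' \<open>\<nu> \<noteq> \<mu>'\<close> by simp
  qed
  \<comment> \<open>Of the gap 2 D / 3 at most D / 3 is lost to the suboptimality of the plan behind
    \<open>a k\<close>. The coupling behind \<open>b k\<close> may be far from optimal, since an
    upper bound for the distance to \<open>\<mu>'\<close> is enough.\<close>
  have "\<forall>\<^sub>F k in sequentially. 2 * D / 3 < a k - b k"
    using lim_ab \<open>0 < D\<close> by (intro order_tendstoD(1)) auto
  moreover have "(\<lambda>k. 1 / real (Suc (r k))) \<longlonglongrightarrow> 0"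
    using LIMSEQ_subseq_LIMSEQ[OF LIMSEQ_Suc[OF lim_1_over_n] r(1)] by (simp add: comp_def)
  then have "\<forall>\<^sub>F k in sequentially. 1 / real (Suc (r k)) < D / 3"
    using \<open>0 < D\<close> by (intro order_tendstoD(2)) auto
  ultimately have "\<forall>\<^sub>F k in sequentially. (W2 \<mu>' (\<mu> (r k)))\<^sup>2 + D / 3 \<le> (W2 \<nu> (\<mu> (r k)))\<^sup>2"
  proof eventually_elim
    case (elim k)
    have "a k = (\<integral>z. (norm (fst z - snd z))\<^sup>2 \<partial>\<gamma> (r k))"
      unfolding dZ[symmetric] a_def Y_def X_def by (subst integral_distr) auto
    moreover have "(W2 \<mu>' (\<mu> (r k)))\<^sup>2 \<le> b k"
      using W2_le_coupling[OF Z.prob_space_axioms X.Y X.X X'2(1) X2(1)] by (simp add: dX' dX b_def)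
    ultimately show ?case using elim opt[of "r k"] by linarith
  qed
  moreover have "0 < D / 3" using \<open>0 < D\<close> by simp
  ultimately show thesis using r(1) by (intro that)
qed

section \<open>Fixed points\<close>

text \<open>Eventual membership passes from the subbasis to finite intersections and arbitrary
  unions, by induction on the generated topology.\<close>

lemma limitin_P2w_if_tests_converge:
  assumes "\<And>k. \<mu> k \<in> P2" "\<nu> \<in> P2"
    and lim: "\<And>\<zeta>. \<zeta> \<in> P2w_test \<Longrightarrow> (\<lambda>k. \<integral>x. \<zeta> x \<partial>\<mu> k) \<longlonglongrightarrow> (\<integral>x. \<zeta> x \<partial>\<nu>)"
  shows "limitin P2w \<mu> \<nu> sequentially"
  unfolding limitin_def
proof (intro conjI allI impI)
  fix U assume "openin P2w U \<and> \<nu> \<in> U"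
  then have "generate_topology_on {{\<mu> \<in> P2. (\<integral>x. \<zeta> x \<partial>\<mu>) \<in> U} | \<zeta> U. \<zeta> \<in> P2w_test \<and> open U} U" "\<nu> \<in> U"
    by (auto simp: P2w_def openin_topology_generated_by_iff)
  then show "\<forall>\<^sub>F k in sequentially. \<mu> k \<in> U"
  proof induction
    case (Int a b)
    then show ?case by (auto intro: eventually_conj)
  next
    case (UN K)
    then obtain k where "k \<in> K" "\<nu> \<in> k" by blast
    then show ?case using UN.IH[of k] by (auto elim: eventually_mono)
  next
    case (Basis s)
    then obtain \<zeta> V where s: "s = {\<mu> \<in> P2. (\<integral>x. \<zeta> x \<partial>\<mu>) \<in> V}" "\<zeta> \<in> P2w_test" "open V" by blast
    then have "\<forall>\<^sub>F k in sequentially. (\<integral>x. \<zeta> x \<partial>\<mu> k) \<in> V"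
      using Basis lim[OF s(2)] by (intro topological_tendstoD) auto
    then show ?case using assms(1) s(1) by (auto elim: eventually_mono)
  qed simp
qed (use assms(2) in simp)

lemma W2_ball_second_moment:
  fixes \<mu> \<nu> :: "'a::{real_inner, second_countable_topology} measure"
  assumes "\<nu> \<in> P2" "\<mu> \<in> P2" "W2 \<nu> \<mu> \<le> C"
  shows "(\<integral>x. (norm x)\<^sup>2 \<partial>\<mu>) \<le> 2 * (\<integral>x. (norm x)\<^sup>2 \<partial>\<nu>) + 2 * (C\<^sup>2 + 1)"
proof -
  \<comment> \<open>The summand 1 supplies the strict inequality required by
    \<open>near_optimal_plan\<close>.\<close>
  have "(W2 \<nu> \<mu>)\<^sup>2 < C\<^sup>2 + 1" using power_mono[OF assms(3) W2_nonneg, of 2] by simp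
  then obtain \<gamma> where \<gamma>: "\<gamma> \<in> plans \<nu> \<mu>" "(\<integral>z. (norm (fst z - snd z))\<^sup>2 \<partial>\<gamma>) < C\<^sup>2 + 1"
    by (rule near_optimal_plan[OF assms(1,2)])
  note p = plans_integrable[OF \<gamma>(1) assms(1,2)]
  have "(\<integral>z. (norm (snd z))\<^sup>2 \<partial>\<gamma>) \<le> (\<integral>z. 2 * (norm (fst z))\<^sup>2 + 2 * (norm (fst z - snd z))\<^sup>2 \<partial>\<gamma>)"
  proof (rule integral_mono)
    show "(norm (snd z))\<^sup>2 \<le> 2 * (norm (fst z))\<^sup>2 + 2 * (norm (fst z - snd z))\<^sup>2" for z :: "'a \<times> 'a"
      using norm_diff_sq_le[of "fst z" "fst z - snd z"] by simp
  qed (use p in simp_all)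
  then show ?thesis using p \<gamma>(2) by simp
qed

text \<open>Applied to the integrals of one test function at a time, this moves the subsequence
  principle from \<open>P2w\<close> to the real line.\<close>

lemma tendsto_if_subseq_subseq:
  fixes a :: "nat \<Rightarrow> real"
  assumes "\<And>s. strict_mono (s :: nat \<Rightarrow> nat) \<Longrightarrow> \<exists>r. strict_mono (r :: nat \<Rightarrow> nat) \<and> (\<lambda>k. a (s (r k))) \<longlonglongrightarrow> L"
  shows "a \<longlonglongrightarrow> L"
proof (rule ccontr)
  assume "\<not> a \<longlonglongrightarrow> L"
  then obtain e where "0 < e" and "\<not> (\<forall>\<^sub>F k in sequentially. dist (a k) L < e)" unfolding tendsto_iff by blast
  then have "\<exists>\<^sub>F k in sequentially. e \<le> dist (a k) L" by (simp add: frequently_def not_le)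
  then have "infinite {k. e \<le> dist (a k) L}" by (simp add: frequently_cofinite[symmetric] cofinite_eq_sequentially)
  then obtain s where s: "strict_mono (s :: nat \<Rightarrow> nat)" "\<And>k. s k \<in> {k. e \<le> dist (a k) L}"
    using infinite_enumerate by blast
  obtain r where "(\<lambda>k. a (s (r k))) \<longlonglongrightarrow> L" using assms[OF s(1)] by blast
  then have "\<forall>\<^sub>F k in sequentially. dist (a (s (r k))) L < e" using \<open>0 < e\<close> by (rule tendstoD)
  then have "\<forall>\<^sub>F k :: nat in sequentially. False"
    by (rule eventually_mono) (use s(2) in \<open>auto simp: not_less[symmetric]\<close>)
  then show False by simp
qed

theorem theorem6p9:
  fixes A :: "'a::{real_inner, complete_space, second_countable_topology} measure set"
    and T :: "'a measure \<Rightarrow> 'a measure"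
    and \<mu> :: "'a measure"
  assumes "closedin P2w A"
    and "T \<in> A \<rightarrow> A"
    and "nonexpansive_on A T"
    and "asymptotically_regular_on A T"
    and "\<mu> \<in> A"
  shows "((\<exists>\<nu>\<in>A. T \<nu> = \<nu>) \<longleftrightarrow> W2_bounded (range (\<lambda>k. (T ^^ k) \<mu>))) \<and>
    (W2_bounded (range (\<lambda>k. (T ^^ k) \<mu>)) \<longrightarrow>
      (\<exists>\<nu>\<in>A. T \<nu> = \<nu> \<and> limitin P2w (\<lambda>k. (T ^^ k) \<mu>) \<nu> sequentially))"
proof -
  define m where "m k = (T ^^ k) \<mu>" for k
  have AP2: "A \<subseteq> P2" using closedin_subset[OF assms(1)] by simp
  have mA: "m k \<in> A" for k
    unfolding m_def by (induction k) (use assms(2,5) in auto)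
  have mP2: "m k \<in> P2" for k using mA AP2 by blast
  have m_Suc: "m (Suc k) = T (m k)" for k by (simp add: m_def)
  have nonexp: "W2 (T \<nu>) (m (Suc k)) \<le> W2 \<nu> (m k)" if "\<nu> \<in> A" for \<nu> k
    using assms(3) that mA[of k] unfolding nonexpansive_on_def m_Suc by blast
  have antimono: "decseq (\<lambda>k. W2 \<nu> (m k))" if "\<nu> \<in> A" "T \<nu> = \<nu>" for \<nu>
    using nonexp[OF that(1)] that(2) by (intro decseq_SucI) simp
  have reg: "(\<lambda>k. W2 (m (Suc k)) (m k)) \<longlonglongrightarrow> 0"
    using assms(4,5) unfolding asymptotically_regular_on_def m_def by blast
  have fix_bounded: "W2_bounded (range m)" if \<nu>: "\<nu> \<in> A" "T \<nu> = \<nu>" for \<nu>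
    unfolding W2_bounded_def
  proof (intro conjI bexI exI ballI)
    show "range m \<subseteq> P2" using mP2 by blast
    show "\<nu> \<in> P2" using \<nu> AP2 by blast
    fix \<rho> assume "\<rho> \<in> range m"
    then show "W2 \<nu> \<rho> \<le> W2 \<nu> (m 0)" using decseqD[OF antimono[OF \<nu>], of 0] by auto
  qed
  have bounded_conv: "\<exists>\<nu>\<in>A. T \<nu> = \<nu> \<and> limitin P2w m \<nu> sequentially" if bdd: "W2_bounded (range m)"
  proof -
    obtain C where C: "\<And>k. (\<integral>x. (norm x)\<^sup>2 \<partial>m k) \<le> C"
    proof -
      obtain \<nu> D where "\<nu> \<in> P2" "\<And>k. W2 \<nu> (m k) \<le> D" using bdd unfolding W2_bounded_def by blast
      then show thesis using that W2_ball_second_moment mP2 by blast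
    qed
    \<comment> \<open>Cluster points along a subsequence \<open>s\<close>, expressed by test
      integrals, the form in which Opial's property takes its hypothesis. Membership in
      \<open>A\<close> will come from weak closedness.\<close>
    let ?lim = "\<lambda>s \<nu>. strict_mono (s :: nat \<Rightarrow> nat) \<and> \<nu> \<in> A \<and>
      (\<forall>\<zeta>\<in>P2w_test. (\<lambda>k. \<integral>x. \<zeta> x \<partial>m (s k)) \<longlonglongrightarrow> (\<integral>x. \<zeta> x \<partial>\<nu>))"
    have compact: "\<exists>(r :: nat \<Rightarrow> nat) \<nu>. strict_mono r \<and> ?lim (\<lambda>k. s (r k)) \<nu>" if s: "strict_mono s" for s :: "nat \<Rightarrow> nat"
    proof -
      obtain r \<nu> where r: "strict_mono r" "\<nu> \<in> P2"
        "\<And>\<zeta>. \<zeta> \<in> P2w_test \<Longrightarrow> (\<lambda>k. \<integral>x. \<zeta> x \<partial>m (s (r k))) \<longlonglongrightarrow> (\<integral>x. \<zeta> x \<partial>\<nu>)"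
        using P2w_test_compactness[of "\<lambda>k. m (s k)" C] mP2 C by blast
      have "limitin P2w (\<lambda>k. m (s (r k))) \<nu> sequentially"
        by (rule limitin_P2w_if_tests_converge) (use mP2 r in auto)
      then have "\<nu> \<in> A"
        by (rule limitin_closedin[OF _ assms(1)]) (use mA in auto)
      moreover have "strict_mono (\<lambda>k. s (r k))" using strict_mono_o[OF s r(1)] by (simp add: comp_def)
      ultimately show ?thesis using r by blast
    qed
    have opial': "\<exists>(r :: nat \<Rightarrow> nat) \<delta>. strict_mono r \<and> 0 < \<delta> \<and>
        (\<forall>\<^sub>F k in sequentially. (W2 \<nu> (m (s (r k))))\<^sup>2 + \<delta> \<le> (W2 \<rho> (m (s (r k))))\<^sup>2)"
      if s: "?lim s \<nu>" and \<rho>: "\<rho> \<in> A" "\<rho> \<noteq> \<nu>" for s :: "nat \<Rightarrow> nat" and \<nu> \<rho>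
    proof -
      have "\<nu> \<in> P2" "\<rho> \<in> P2" using s \<rho>(1) AP2 by auto
      then obtain r \<delta> where "strict_mono r" "0 < \<delta>"
          "\<forall>\<^sub>F k in sequentially. (W2 \<nu> (m (s (r k))))\<^sup>2 + \<delta> \<le> (W2 \<rho> (m (s (r k))))\<^sup>2"
        using opial[of "\<lambda>k. m (s k)" C \<nu> \<rho>] mP2 C \<rho>(2) s by blast
      then show ?thesis by blast
    qed
    have fixed: "T \<nu> = \<nu>" if s: "?lim s \<nu>" for s :: "nat \<Rightarrow> nat" and \<nu>
    proof (rule ccontr)
      assume "T \<nu> \<noteq> \<nu>"
      have \<nu>: "\<nu> \<in> A" "T \<nu> \<in> A" using s assms(2) by auto
      then obtain r :: "nat \<Rightarrow> nat" and \<delta> where r: "strict_mono r" "0 < \<delta>"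
          "\<forall>\<^sub>F k in sequentially. (W2 \<nu> (m (s (r k))))\<^sup>2 + \<delta> \<le> (W2 (T \<nu>) (m (s (r k))))\<^sup>2"
        using opial'[OF s _ \<open>T \<nu> \<noteq> \<nu>\<close>] by blast
      obtain B where B: "\<And>k. W2 \<nu> (m k) \<le> B" "0 \<le> B"
      proof -
        obtain \<rho> D where \<rho>: "\<rho> \<in> P2" "\<And>k. W2 \<rho> (m k) \<le> D" using bdd unfolding W2_bounded_def by blast
        have "W2 \<nu> (m k) \<le> W2 \<nu> \<rho> + D" for k
          using W2_triangle[of \<nu> \<rho> "m k"] \<rho>(2)[of k] \<rho>(1) mP2[of k] \<nu>(1) AP2 by (smt (verit) subset_iff)
        moreover from this[of 0] have "0 \<le> W2 \<nu> \<rho> + D" using W2_nonneg order_trans by blast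
        ultimately show thesis by (rule that)
      qed
      let ?d = "\<lambda>k. W2 (m (Suc k)) (m k)"
      \<comment> \<open>Non-expansiveness bounds the distance from \<open>T \<nu>\<close> to the
        next point of the orbit; asymptotic regularity pays for stepping back from
        \<open>m (Suc k)\<close> to \<open>m k\<close>.\<close>
      have close: "W2 (T \<nu>) (m k) \<le> W2 \<nu> (m k) + ?d k" for k
      proof -
        have "W2 (T \<nu>) (m k) \<le> W2 (T \<nu>) (m (Suc k)) + ?d k"
          by (rule W2_triangle) (use \<nu> AP2 mP2 in auto)
        then show ?thesis using nonexp[OF \<nu>(1), of k] by linarith
      qed
      \<comment> \<open>Opial's gap is a gap between squares, so the vanishing error has to be
        squared too. The bound \<open>B\<close> makes the resulting error tend to 0 as well.\<close>
      have sq: "(W2 (T \<nu>) (m k))\<^sup>2 \<le> (W2 \<nu> (m k))\<^sup>2 + (2 * B + ?d k) * ?d k" for k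
      proof -
        have "(W2 (T \<nu>) (m k))\<^sup>2 \<le> (W2 \<nu> (m k) + ?d k)\<^sup>2" using close by (intro power_mono) auto
        also have "\<dots> = (W2 \<nu> (m k))\<^sup>2 + (2 * W2 \<nu> (m k) + ?d k) * ?d k"
          by (simp add: power2_eq_square algebra_simps)
        also have "\<dots> \<le> (W2 \<nu> (m k))\<^sup>2 + (2 * B + ?d k) * ?d k"
          using B(1)[of k] by (intro add_left_mono mult_right_mono) auto
        finally show ?thesis .
      qed
      have "(\<lambda>k. (2 * B + ?d k) * ?d k) \<longlonglongrightarrow> (2 * B + 0) * 0"
        by (intro tendsto_mult tendsto_add tendsto_const reg)
      then have "(\<lambda>k. (2 * B + ?d (s (r k))) * ?d (s (r k))) \<longlonglongrightarrow> 0"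
        using LIMSEQ_subseq_LIMSEQ[of "\<lambda>k. (2 * B + ?d k) * ?d k" 0 "s \<circ> r"] strict_mono_o[of s r] s r(1)
        by (simp add: comp_def)
      then have "\<forall>\<^sub>F k in sequentially. (2 * B + ?d (s (r k))) * ?d (s (r k)) < \<delta>"
        using r(2) by (rule order_tendstoD(2))
      with r(3) have "\<forall>\<^sub>F k :: nat in sequentially. False"
        by eventually_elim (use sq in \<open>smt (verit)\<close>)
      then show False by simp
    qed
    \<comment> \<open>Opial's gap is available only along a subsequence. Distances to fixed points
      converge along the whole orbit, so the gap already orders the full limits; exchanging two
      cluster points then gives a contradiction.\<close>
    have less: "lim (\<lambda>k. W2 \<nu> (m k)) < lim (\<lambda>k. W2 \<rho> (m k))"
      if s: "?lim s \<nu>" and \<rho>: "\<rho> \<in> A" "T \<rho> = \<rho>" "\<rho> \<noteq> \<nu>" for s :: "nat \<Rightarrow> nat" and \<nu> \<rho>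
    proof -
      have cv: "(\<lambda>k. W2 \<sigma> (m k)) \<longlonglongrightarrow> lim (\<lambda>k. W2 \<sigma> (m k))" if \<sigma>: "\<sigma> \<in> A" "T \<sigma> = \<sigma>" for \<sigma>
      proof -
        have "\<forall>k. 0 \<le> W2 \<sigma> (m k)" by simp
        then obtain L where "(\<lambda>k. W2 \<sigma> (m k)) \<longlonglongrightarrow> L"
          by (rule decseq_convergent[OF antimono[OF \<sigma>]])
        then have "convergent (\<lambda>k. W2 \<sigma> (m k))" unfolding convergent_def by (rule exI)
        then show ?thesis by (rule convergent_LIMSEQ_iff[THEN iffD1])
      qed
      obtain r :: "nat \<Rightarrow> nat" and \<delta> where r: "strict_mono r" "0 < \<delta>"
          "\<forall>\<^sub>F k in sequentially. (W2 \<nu> (m (s (r k))))\<^sup>2 + \<delta> \<le> (W2 \<rho> (m (s (r k))))\<^sup>2"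
        using opial'[OF s \<rho>(1,3)] by blast
      have sub: "(\<lambda>k. W2 \<sigma> (m (s (r k)))) \<longlonglongrightarrow> lim (\<lambda>k. W2 \<sigma> (m k))" if "\<sigma> \<in> A" "T \<sigma> = \<sigma>" for \<sigma>
        using LIMSEQ_subseq_LIMSEQ[OF cv[OF that], of "s \<circ> r"] strict_mono_o[of s r] s r(1)
        by (simp add: comp_def)
      have "(lim (\<lambda>k. W2 \<nu> (m k)))\<^sup>2 + \<delta> \<le> (lim (\<lambda>k. W2 \<rho> (m k)))\<^sup>2"
      proof (rule tendsto_le[OF sequentially_bot _ _ r(3)])
        show "(\<lambda>k. (W2 \<rho> (m (s (r k))))\<^sup>2) \<longlonglongrightarrow> (lim (\<lambda>k. W2 \<rho> (m k)))\<^sup>2"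
          by (intro tendsto_power sub \<rho>)
        have "\<nu> \<in> A" using s by blast
        then show "(\<lambda>k. (W2 \<nu> (m (s (r k))))\<^sup>2 + \<delta>) \<longlonglongrightarrow> (lim (\<lambda>k. W2 \<nu> (m k)))\<^sup>2 + \<delta>"
          by (intro tendsto_add tendsto_const tendsto_power sub fixed[OF s])
      qed
      then have "(lim (\<lambda>k. W2 \<nu> (m k)))\<^sup>2 < (lim (\<lambda>k. W2 \<rho> (m k)))\<^sup>2" using r(2) by linarith
      moreover have "0 \<le> lim (\<lambda>k. W2 \<rho> (m k))"
        using cv[OF \<rho>(1,2)] W2_nonneg by (intro LIMSEQ_le_const) auto
      ultimately show ?thesis by (rule power2_less_imp_less)
    qed
    obtain s\<^sub>0 \<nu> where \<nu>: "?lim s\<^sub>0 \<nu>" using compact[OF strict_mono_id] by auto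
    have unique: "\<rho> = \<nu>" if "?lim s \<rho>" for s :: "nat \<Rightarrow> nat" and \<rho>
    proof (rule ccontr)
      assume "\<rho> \<noteq> \<nu>"
      have A: "\<nu> \<in> A" "\<rho> \<in> A" using \<nu> that by auto
      have "lim (\<lambda>k. W2 \<nu> (m k)) < lim (\<lambda>k. W2 \<rho> (m k))"
        by (rule less[OF \<nu> A(2) fixed[OF that] \<open>\<rho> \<noteq> \<nu>\<close>])
      moreover have "lim (\<lambda>k. W2 \<rho> (m k)) < lim (\<lambda>k. W2 \<nu> (m k))"
        by (rule less[OF that A(1) fixed[OF \<nu>] \<open>\<rho> \<noteq> \<nu>\<close>[symmetric]])
      ultimately show False by simp
    qed
    have "limitin P2w m \<nu> sequentially"
    proof (rule limitin_P2w_if_tests_converge)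
      fix \<zeta> :: "'a \<Rightarrow> real" assume \<zeta>: "\<zeta> \<in> P2w_test"
      show "(\<lambda>k. \<integral>x. \<zeta> x \<partial>m k) \<longlonglongrightarrow> (\<integral>x. \<zeta> x \<partial>\<nu>)"
      proof (rule tendsto_if_subseq_subseq)
        fix s :: "nat \<Rightarrow> nat" assume "strict_mono s"
        then obtain r \<rho> where r: "strict_mono r" "?lim (\<lambda>k. s (r k)) \<rho>" using compact by blast
        then have "\<rho> = \<nu>" using unique by blast
        then show "\<exists>r. strict_mono r \<and> (\<lambda>k. \<integral>x. \<zeta> x \<partial>m (s (r k))) \<longlonglongrightarrow> (\<integral>x. \<zeta> x \<partial>\<nu>)"
          using r \<zeta> by blast
      qed
    qed (use mP2 \<nu> AP2 in auto)
    then show ?thesis using \<nu> fixed[OF \<nu>] by blast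
  qed
  show ?thesis
    using fix_bounded bounded_conv unfolding m_def[abs_def] by blast
qed

end
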